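(* Let $F : [0,\infty) \to \mathbb{R}$ and let $d$ and $p$ be positive integers, with $p < d$. The following are equivalent. (1) $F$ preserves $\mathrm{TN}_p$ entrywise on symmetric $d \times d$ matrices. (2) $F$ preserves $\mathrm{TN}_p$ entrywise on $d \times d$ matrices. (3) $F$ is either a non-negative constant or: (a) ($p = 1$) $F(x) \geq 0$; (b) ($p = 2$) $F(x) = c x^\alpha$ for some $c > 0$ and some $\alpha \geq 0$; (c) ($p = 3$) $F(x) = c x^\alpha$ for some $c > 0$ and some $\alpha \geq 1$; (d) ($p \geq 4$) $F(x) = cx$ for some $c > 0$. The same functions characterize the preservers of symmetric $\mathrm{TN}_p$ kernels on $X \times X$, where $X$ is a totally ordered set of size at least $p+1$ (and possibly infinite).
   Context: A real matrix is $\mathrm{TN}_p$ if all of its minors of size $r \times r$ with $1 \leq r \leq p$ are non-negative. For a matrix $A = (a_{ij})$ with entries in $[0,\infty)$, $F[A] := (F(a_{ij}))$; "$F$ preserves $\mathrm{TN}_p$ entrywise" on a class of matrices means that $F[A]$ is $\mathrm{TN}_p$ for every $\mathrm{TN}_p$ matrix $A$ in the class. For a totally ordered set $X$, a kernel $K : X \times X \to \mathbb{R}$ is $\mathrm{TN}_p$ if $\det(K(x_i,y_j))_{i,j=1}^n \geq 0$ for all $n \in \{1,\dots,p\}$ and all $x_1 < \cdots < x_n$, $y_1 < \cdots < y_n$ in $X$; it is symmetric if $K(x,y) = K(y,x)$ for all $x,y \in X$. $F$ is a preserver of symmetric $\mathrm{TN}_p$ kernels on $X \times X$ if $F \circ K$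 is $\mathrm{TN}_p$ for every symmetric $\mathrm{TN}_p$ kernel $K$ on $X \times X$. The convention $0^0 := 1$ is used.
   Formalization: In (3)(b), p = 2, the alternative F(0) = 0 and F(x) = c for x > 0 (c > 0) is added: with 0^0 := 1 this F preserves TN_2 but is neither constant nor of the form c x^α, so the stated equivalence fails without it. *)

theory Defs
  imports
    "HOL-Analysis.Analysis"
    "Jordan_Normal_Form.Determinant"
    "Jordan_Normal_Form.DL_Submatrix"
begin

hide_const (open) Determinants.det

definition TN_mat :: "nat \<Rightarrow> real mat \<Rightarrow> bool" where
  "TN_mat p A \<longleftrightarrow>
     (\<forall>r I J. 1 \<le> r \<and> r \<le> p \<and> I \<subseteq> {..<dim_row A} \<and> J \<subseteq> {..<dim_col A}
        \<and> card I = r \<and> card J = r \<longrightarrow> 0 \<le> det (submatrix A I J))"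

(* Functions [0,\<infinity>) \<rightarrow> \<real> are modelled by total functions on the reals. The
   entries of a TN_mat p matrix with p \<ge> 1 are its 1 x 1 minors, hence nonnegative, so
   only the values on [0,\<infinity>) matter below; the same applies to kernels. *)

definition preserves_TN_mat :: "nat \<Rightarrow> nat \<Rightarrow> (real \<Rightarrow> real) \<Rightarrow> bool" where
  "preserves_TN_mat p d F \<longleftrightarrow>
     (\<forall>A \<in> carrier_mat d d. TN_mat p A \<longrightarrow> TN_mat p (map_mat F A))"

definition preserves_TN_sym_mat :: "nat \<Rightarrow> nat \<Rightarrow> (real \<Rightarrow> real) \<Rightarrow> bool" where
  "preserves_TN_sym_mat p d F \<longleftrightarrow>
     (\<forall>A \<in> carrier_mat d d. transpose_mat A = A \<and> TN_mat p A \<longrightarrow> TN_mat p (map_mat F A))"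

definition TN_kernel_on :: "nat \<Rightarrow> 'a::linorder set \<Rightarrow> ('a \<Rightarrow> 'a \<Rightarrow> real) \<Rightarrow> bool" where
  "TN_kernel_on p X K \<longleftrightarrow>
     (\<forall>n x y. 1 \<le> n \<and> n \<le> p
        \<and> strict_mono_on {..<n} x \<and> x ` {..<n} \<subseteq> X
        \<and> strict_mono_on {..<n} y \<and> y ` {..<n} \<subseteq> X
        \<longrightarrow> 0 \<le> det (mat n n (\<lambda>(i, j). K (x i) (y j))))"

definition sym_kernel_on :: "'a set \<Rightarrow> ('a \<Rightarrow> 'a \<Rightarrow> real) \<Rightarrow> bool" where
  "sym_kernel_on X K \<longleftrightarrow> (\<forall>x \<in> X. \<forall>y \<in> X. K x y = K y x)"

definition preserves_TN_sym_kernel ::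
    "nat \<Rightarrow> 'a::linorder set \<Rightarrow> (real \<Rightarrow> real) \<Rightarrow> bool" where
  "preserves_TN_sym_kernel p X F \<longleftrightarrow>
     (\<forall>K. sym_kernel_on X K \<and> TN_kernel_on p X K \<longrightarrow> TN_kernel_on p X (\<lambda>x y. F (K x y)))"

(* Real powers of x \<ge> 0 with 0^0 = 1, whereas 0 powr 0 = 0. *)
definition rpow :: "real \<Rightarrow> real \<Rightarrow> real" where
  "rpow x \<alpha> = (if \<alpha> = 0 then 1 else x powr \<alpha>)"

(* The last alternative for p = 2, c times the indicator function of (0,\<infinity>), is the
   limit of c x^\<alpha> as \<alpha> \<rightarrow> 0+. It is easily overlooked, since with 0^0 = 1 it is not c x^0; but it
   preserves TN_2 (if a, b, c, d \<ge> 0, ad \<ge> bc and b, c > 0, then a, d > 0), so the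
   characterization would be false without it. *)
definition TN_preserver_form :: "nat \<Rightarrow> (real \<Rightarrow> real) \<Rightarrow> bool" where
  "TN_preserver_form p F \<longleftrightarrow>
     (\<exists>c \<ge> 0. \<forall>x \<ge> 0. F x = c)
     \<or> (p = 1 \<and> (\<forall>x \<ge> 0. 0 \<le> F x))
     \<or> (p = 2 \<and> (\<exists>c > 0. (\<exists>\<alpha> \<ge> 0. \<forall>x \<ge> 0. F x = c * rpow x \<alpha>)
                       \<or> (\<forall>x \<ge> 0. F x = (if x = 0 then 0 else c))))
     \<or> (p = 3 \<and> (\<exists>c > 0. \<exists>\<alpha> \<ge> 1. \<forall>x \<ge> 0. F x = c * rpow x \<alpha>))
     \<or> (4 \<le> p \<and> (\<exists>c > 0. \<forall>x \<ge> 0. F x = c * x))"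

end

theory Submission
  imports Defs "HOL-Real_Asymp.Real_Asymp"
begin

text \<open>
  Padding by zeros turns a symmetric TN kernel on \<open>{0, \<dots>, m - 1}\<close>, \<open>m \<le> p + 1\<close>, into one on any larger
  chain, so all three classes are tested by symmetric matrices of size at most \<open>p + 1\<close>.
  For \<open>p \<ge> 2\<close>, the matrices \<open>[[y, x], [x, y]]\<close> with \<open>x \<le> y\<close> force \<open>F\<close> to be monotone, and the
  off-diagonal minors of \<open>u u\<^sup>T\<close> with \<open>u\<close> of length 3 force \<open>F / F(1)\<close> to be multiplicative on the positive
  reals; hence \<open>F\<close> is constant, a power or an indicator there. For \<open>p \<ge> 3\<close>, a singular tridiagonal matrix
  excludes indicators and exponents below 1. For \<open>p \<ge> 4\<close> and an exponent \<open>\<alpha> > 1\<close>, a small rank 2 perturbation of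
  the all-ones 5 x 5 matrix has a vanishing 4 x 4 minor whose entrywise power is negative.
  Conversely, the case \<open>p = 3\<close> needs that powers with \<open>\<alpha> \<ge> 1\<close> preserve TN 3 x 3 matrices: after scaling,
  this is the monotonicity of \<open>((f + k v)\<^sup>\<alpha> - f\<^sup>\<alpha>) / ((1 + v)\<^sup>\<alpha> - 1)\<close> in \<open>v\<close> for \<open>0 \<le> f \<le> k\<close>.
\<close>

section \<open>Determinants and totally nonnegative kernels\<close>

text \<open>Laplace expansion along the first column. Deleting row \<open>i\<close> is encoded by
  the index shift \<open>if k < i then k else Suc k\<close>, so each minor is again the
  \<open>mat\<close> of a function and unfolding can be iterated.\<close>

lemma det_mat_Suc:
  fixes f :: "nat \<Rightarrow> nat \<Rightarrow> 'a::comm_ring_1"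
  shows "det (mat (Suc n) (Suc n) (\<lambda>(i, j). f i j)) =
    (\<Sum>i<Suc n. f i 0 * ((-1) ^ i *
       det (mat n n (\<lambda>(k, l). f (if k < i then k else Suc k) (Suc l)))))"
proof -
  let ?M = "mat (Suc n) (Suc n) (\<lambda>(i, j). f i j)"
  have del: "mat_delete ?M i 0 = mat n n (\<lambda>(k, l). f (if k < i then k else Suc k) (Suc l))"
    if "i < Suc n" for i
    using that by (intro eq_matI) (auto simp: mat_delete_def)
  show ?thesis
    by (subst laplace_expansion_column[of ?M "Suc n" 0])
      (auto intro!: sum.cong simp: cofactor_def del)
qed

lemma det_mat_0: "det (mat 0 0 f) = 1"
  by (rule det_dim_zero) simp

lemma det_mat_1:
  fixes f :: "nat \<Rightarrow> nat \<Rightarrow> 'a::comm_ring_1"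
  shows "det (mat 1 1 (\<lambda>(i, j). f i j)) = f 0 0"
  unfolding One_nat_def det_mat_Suc by (simp add: det_mat_0)

lemma det_mat_2:
  fixes f :: "nat \<Rightarrow> nat \<Rightarrow> 'a::comm_ring_1"
  shows "det (mat 2 2 (\<lambda>(i, j). f i j)) = f 0 0 * f 1 1 - f 0 1 * f 1 0"
  unfolding numeral_2_eq_2 det_mat_Suc by (simp add: det_mat_0)

lemma det_mat_3:
  fixes f :: "nat \<Rightarrow> nat \<Rightarrow> 'a::comm_ring_1"
  shows "det (mat 3 3 (\<lambda>(i, j). f i j)) =
      f 0 0 * (f 1 1 * f 2 2 - f 1 2 * f 2 1) - f 0 1 * (f 1 0 * f 2 2 - f 1 2 * f 2 0)
    + f 0 2 * (f 1 0 * f 2 1 - f 1 1 * f 2 0)"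
  unfolding numeral_3_eq_3 det_mat_Suc
  by (simp add: det_mat_0 numeral_2_eq_2 algebra_simps)

lemma det_mat_4:
  fixes f :: "nat \<Rightarrow> nat \<Rightarrow> 'a::comm_ring_1"
  shows "det (mat 4 4 (\<lambda>(i, j). f i j)) =
    (\<Sum>i<4. f i 0 * ((-1) ^ i *
       det (mat 3 3 (\<lambda>(k, l). f (if k < i then k else Suc k) (Suc l)))))"
  using det_mat_Suc[of 3 f] by simp

lemma det_mat_smult:
  fixes f :: "nat \<Rightarrow> nat \<Rightarrow> 'a::comm_ring_1"
  shows "det (mat n n (\<lambda>(i, j). c * f i j)) = c ^ n * det (mat n n (\<lambda>(i, j). f i j))"
proof -
  have "mat n n (\<lambda>(i, j). c * f i j) = c \<cdot>\<^sub>m mat n n (\<lambda>(i, j). f i j)"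
    by (intro eq_matI) auto
  then show ?thesis by simp
qed

text \<open>Every term of the Leibniz formula contains an entry of row \<open>k\<close>.\<close>

lemma det_mat_zero_row:
  fixes f :: "nat \<Rightarrow> nat \<Rightarrow> 'a::comm_ring_1"
  assumes "k < n" and "\<And>j. j < n \<Longrightarrow> f k j = 0"
  shows "det (mat n n (\<lambda>(i, j). f i j)) = 0"
proof -
  have "(\<Prod>i = 0..<n. mat n n (\<lambda>(i, j). f i j) $$ (i, q i)) = 0"
    if "q permutes {0..<n}" for q
    using assms permutes_in_image[OF that, of k] by (intro prod_zero) (auto intro!: bexI[of _ k])
  then show ?thesis by (subst det_def'[of _ n]) auto
qed

lemma det_mat_transpose:
  fixes f :: "nat \<Rightarrow> nat \<Rightarrow> 'a::comm_ring_1"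
  shows "det (mat n n (\<lambda>(i, j). f j i)) = det (mat n n (\<lambda>(i, j). f i j))"
proof -
  have "mat n n (\<lambda>(i, j). f j i) = transpose_mat (mat n n (\<lambda>(i, j). f i j))"
    by (intro eq_matI) auto
  then show ?thesis by (simp add: det_transpose[of _ n])
qed

text \<open>A sum of \<open>m\<close> rank 1 terms is a product of two square matrices padded with
  zeros; row \<open>m\<close> of the right factor vanishes.\<close>

lemma det_mat_low_rank:
  fixes u v :: "nat \<Rightarrow> nat \<Rightarrow> 'a::comm_ring_1"
  assumes "m < n"
  shows "det (mat n n (\<lambda>(i, j). \<Sum>k<m. u k i * v k j)) = 0"
proof -
  let ?U = "mat n n (\<lambda>(i, k). if k < m then u k i else 0)"
  let ?V = "mat n n (\<lambda>(k, j). if k < m then v k j else 0)"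
  have "mat n n (\<lambda>(i, j). \<Sum>k<m. u k i * v k j) = ?U * ?V"
  proof (intro eq_matI; simp add: scalar_prod_def)
    fix i j
    show "(\<Sum>k<m. u k i * v k j)
      = (\<Sum>k = 0..<n. (if k < m then u k i else 0) * (if k < m then v k j else 0))"
      using assms by (intro sum.mono_neutral_cong_left) auto
  qed
  moreover have "det ?V = 0"
    using assms det_mat_zero_row[of m n "\<lambda>k j. if k < m then v k j else 0"] by simp
  ultimately show ?thesis by (simp add: det_mult[of _ n])
qed

section \<open>Extracting small minors of a kernel\<close>

lemma TN_kernel_onD:
  assumes "TN_kernel_on p X K" "1 \<le> n" "n \<le> p"
    and "strict_mono_on {..<n} x" "x ` {..<n} \<subseteq> X"
    and "strict_mono_on {..<n} y" "y ` {..<n} \<subseteq> X"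
  shows "0 \<le> det (mat n n (\<lambda>(i, j). K (x i) (y j)))"
  using assms unfolding TN_kernel_on_def by blast

lemma TN_kernel_on_entry:
  assumes "TN_kernel_on p X K" "1 \<le> p" "a \<in> X" "b \<in> X"
  shows "0 \<le> K a b"
proof -
  have "strict_mono_on {..<1} (\<lambda>_::nat. c)" for c :: 'a by (auto simp: strict_mono_on_def)
  then show ?thesis
    using TN_kernel_onD[OF assms(1), of 1 "\<lambda>_. a" "\<lambda>_. b"] assms
    by (auto simp: det_mat_1[unfolded One_nat_def])
qed

lemma TN_kernel_on_minor2:
  assumes "TN_kernel_on p X K" "2 \<le> p" "a \<in> X" "b \<in> X" "c \<in> X" "d \<in> X" "a < b" "c < d"
  shows "K a d * K b c \<le> K a c * K b d"
  using TN_kernel_onD[OF assms(1), of 2 "\<lambda>i. if i = 0 then a else b" "\<lambda>i. if i = 0 then c else d"] assms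
  by (auto simp: strict_mono_on_def det_mat_2)

lemma TN_kernel_on_minor3:
  assumes "TN_kernel_on p X K" "3 \<le> p"
    and "{a1, a2, a3} \<subseteq> X" "{b1, b2, b3} \<subseteq> X" "a1 < a2" "a2 < a3" "b1 < b2" "b2 < b3"
  shows "0 \<le> K a1 b1 * (K a2 b2 * K a3 b3 - K a2 b3 * K a3 b2)
    - K a1 b2 * (K a2 b1 * K a3 b3 - K a2 b3 * K a3 b1)
    + K a1 b3 * (K a2 b1 * K a3 b2 - K a2 b2 * K a3 b1)"
proof -
  let ?s = "\<lambda>c1 c2 c3 i :: nat. if i = 0 then c1 else if i = 1 then c2 else c3"
  have mono: "strict_mono_on {..<3} (?s c1 c2 c3)" if "c1 < c2" "c2 < c3" for c1 c2 c3 :: 'a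
    using that by (auto simp: strict_mono_on_def)
  have sub: "?s c1 c2 c3 ` {..<3} \<subseteq> X" if "{c1, c2, c3} \<subseteq> X" for c1 c2 c3
    using that by auto
  show ?thesis
    using TN_kernel_onD[OF assms(1) _ assms(2) mono[OF assms(5,6)] sub[OF assms(3)]
        mono[OF assms(7,8)] sub[OF assms(4)]] unfolding det_mat_3 by simp
qed

section \<open>Matrices as kernels on finite chains\<close>

text \<open>The elements of the image below \<open>x i\<close> are exactly
  \<open>x 0, ..., x (i - 1)\<close>, so \<open>pick\<close> recovers an increasing sequence from
  its index set.\<close>

lemma pick_strict_mono_image:
  assumes "strict_mono_on {..<n} x" "i < n"
  shows "pick (x ` {..<n}) i = x i"
proof -
  have "{a \<in> x ` {..<n}. a < x i} = x ` {..<i}"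
    using assms by (force simp: strict_mono_on_less)
  moreover have "inj_on x {..<i}"
    using assms by (meson inj_on_subset lessThan_subset_iff less_imp_le strict_mono_on_imp_inj_on)
  ultimately have "card {a \<in> x ` {..<n}. a < x i} = i"
    by (simp add: card_image)
  then show ?thesis
    using pick_card_in_set[of "x i" "x ` {..<n}"] assms by auto
qed

lemma det_submatrix_eq:
  assumes "I \<subseteq> {..<dim_row A}" "J \<subseteq> {..<dim_col A}" "card I = r" "card J = r"
  shows "det (submatrix A I J) = det (mat r r (\<lambda>(i, j). A $$ (pick I i, pick J j)))"
proof -
  have "{i. i < dim_row A \<and> i \<in> I} = I" "{j. j < dim_col A \<and> j \<in> J} = J"
    using assms by auto
  then show ?thesis using assms by (simp add: submatrix_def)
qed

text \<open>Index sets of minors correspond to increasing index sequences, by \<open>pick\<close> in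
  one direction and by images in the other. This moves matrix questions to kernels on
  \<open>{..<d}\<close>.\<close>

lemma TN_mat_iff_kernel:
  assumes A: "A \<in> carrier_mat d d"
  shows "TN_mat p A \<longleftrightarrow> TN_kernel_on p {..<d} (\<lambda>i j. A $$ (i, j))"
proof
  assume tn: "TN_mat p A"
  show "TN_kernel_on p {..<d} (\<lambda>i j. A $$ (i, j))"
    unfolding TN_kernel_on_def
  proof (intro allI impI, elim conjE)
    fix n :: nat and x y :: "nat \<Rightarrow> nat"
    assume n: "1 \<le> n" "n \<le> p"
      and x: "strict_mono_on {..<n} x" "x ` {..<n} \<subseteq> {..<d}"
      and y: "strict_mono_on {..<n} y" "y ` {..<n} \<subseteq> {..<d}"
    have card: "card (x ` {..<n}) = n" "card (y ` {..<n}) = n"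
      using x y by (simp_all add: card_image strict_mono_on_imp_inj_on)
    have "0 \<le> det (submatrix A (x ` {..<n}) (y ` {..<n}))"
      using tn n x y card A unfolding TN_mat_def by auto
    also have "\<dots> = det (mat n n (\<lambda>(i, j). A $$ (pick (x ` {..<n}) i, pick (y ` {..<n}) j)))"
      using x y card A by (intro det_submatrix_eq) auto
    also have "mat n n (\<lambda>(i, j). A $$ (pick (x ` {..<n}) i, pick (y ` {..<n}) j))
      = mat n n (\<lambda>(i, j). A $$ (x i, y j))"
      using x y by (intro eq_matI) (auto simp: pick_strict_mono_image)
    finally show "0 \<le> det (mat n n (\<lambda>(i, j). A $$ (x i, y j)))" .
  qed
next
  assume tn: "TN_kernel_on p {..<d} (\<lambda>i j. A $$ (i, j))"
  have pick: "strict_mono_on {..<r} (pick I)" "pick I ` {..<r} \<subseteq> {..<d}"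
    if "I \<subseteq> {..<d}" "card I = r" for I r
    using that pick_in_set_le[of _ I] by (fastforce simp: strict_mono_on_def intro: pick_mono_le)+
  show "TN_mat p A"
    unfolding TN_mat_def
  proof (intro allI impI, elim conjE)
    fix r :: nat and I J :: "nat set"
    assume *: "1 \<le> r" "r \<le> p" "I \<subseteq> {..<dim_row A}" "J \<subseteq> {..<dim_col A}" "card I = r" "card J = r"
    then show "0 \<le> det (submatrix A I J)"
      using TN_kernel_onD[OF tn *(1,2) pick[of I r] pick[of J r]] A
      by (subst det_submatrix_eq[OF *(3-6)]) auto
  qed
qed

lemma TN_kernel_on_cong:
  assumes "\<And>x y. x \<in> X \<Longrightarrow> y \<in> X \<Longrightarrow> K x y = L x y"
  shows "TN_kernel_on p X K = TN_kernel_on p X L"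
proof -
  have "mat n n (\<lambda>(i, j). K (x i) (y j)) = mat n n (\<lambda>(i, j). L (x i) (y j))"
    if "x ` {..<n} \<subseteq> X" "y ` {..<n} \<subseteq> X" for n and x y :: "nat \<Rightarrow> _"
    using that assms by (intro eq_matI) auto
  then show ?thesis unfolding TN_kernel_on_def by (auto cong: conj_cong)
qed

lemma TN_map_mat_iff_kernel:
  assumes A: "A \<in> carrier_mat d d"
  shows "TN_mat p (map_mat F A) \<longleftrightarrow> TN_kernel_on p {..<d} (\<lambda>i j. F (A $$ (i, j)))"
proof -
  have "map_mat F A \<in> carrier_mat d d" using A by simp
  then show ?thesis
    using A by (subst TN_mat_iff_kernel[of _ d]) (auto intro!: TN_kernel_on_cong)
qed

lemma preserves_TN_sym_mat_imp_kernel: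
  assumes "preserves_TN_sym_mat p d F"
  shows "preserves_TN_sym_kernel p {..<d} F"
  unfolding preserves_TN_sym_kernel_def
proof (intro allI impI, elim conjE)
  fix K :: "nat \<Rightarrow> nat \<Rightarrow> real"
  assume sym: "sym_kernel_on {..<d} K" and tn: "TN_kernel_on p {..<d} K"
  let ?A = "mat d d (\<lambda>(i, j). K i j)"
  have A: "?A \<in> carrier_mat d d" by simp
  have "transpose_mat ?A = ?A"
    using sym by (intro eq_matI) (auto simp: sym_kernel_on_def)
  moreover have "TN_mat p ?A"
    unfolding TN_mat_iff_kernel[OF A] by (subst TN_kernel_on_cong[of _ _ K]) (auto simp: tn)
  ultimately have "TN_mat p (map_mat F ?A)"
    using assms A unfolding preserves_TN_sym_mat_def by blast
  then show "TN_kernel_on p {..<d} (\<lambda>i j. F (K i j))"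
    unfolding TN_map_mat_iff_kernel[OF A]
    by (subst (asm) TN_kernel_on_cong[of _ _ "\<lambda>i j. F (K i j)"]) auto
qed

lemma preserves_TN_kernel_imp_mat:
  assumes "\<And>K. TN_kernel_on p {..<d} K \<Longrightarrow> TN_kernel_on p {..<d} (\<lambda>i j. F (K i j))"
  shows "preserves_TN_mat p d F"
  unfolding preserves_TN_mat_def using assms TN_mat_iff_kernel TN_map_mat_iff_kernel by blast

section \<open>Transfer from general chains to finite chains\<close>

lemma ex_strict_mono_on_into:
  fixes X :: "'a::linorder set"
  assumes "infinite X \<or> m \<le> card X"
  obtains z :: "nat \<Rightarrow> 'a" where "strict_mono_on {..<m} z" "z ` {..<m} \<subseteq> X"
proof -
  obtain Y where Y: "Y \<subseteq> X" "finite Y" "card Y = m"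
    using assms by (meson infinite_arbitrarily_large obtain_subset_with_card_n)
  let ?l = "sorted_list_of_set Y"
  have "strict_mono_on {..<m} (\<lambda>i. ?l ! i)"
    using Y by (auto simp: strict_mono_on_def intro: sorted_wrt_nth_less[OF strict_sorted_list_of_set])
  moreover have "(\<lambda>i. ?l ! i) ` {..<m} \<subseteq> X"
    using Y nth_mem[of _ ?l] by auto
  ultimately show ?thesis using that by blast
qed

text \<open>Extend \<open>K\<close> by zero along an increasing embedding \<open>z\<close> of
  \<open>{..<m}\<close> into \<open>X\<close>. A minor of the extension has a zero row or a zero
  column or is a minor of \<open>K\<close>, so the extension is TN. After \<open>F\<close> is
  applied, only the image of \<open>z\<close> is looked at, so padded entries may become
  nonzero.\<close>

lemma preserves_TN_sym_kernel_embed: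
  fixes X :: "'a::linorder set" and K :: "nat \<Rightarrow> nat \<Rightarrow> real"
  assumes pres: "preserves_TN_sym_kernel p X F"
    and m: "infinite X \<or> m \<le> card X"
    and sym: "sym_kernel_on {..<m} K" and tn: "TN_kernel_on p {..<m} K"
  shows "TN_kernel_on p {..<m} (\<lambda>i j. F (K i j))"
proof -
  obtain z where z: "strict_mono_on {..<m} z" and zX: "z ` {..<m} \<subseteq> X"
    using ex_strict_mono_on_into[OF m] .
  have inj: "inj_on z {..<m}" using z by (rule strict_mono_on_imp_inj_on)
  define w where "w = inv_into {..<m} z"
  have wz: "w (z i) = i" if "i < m" for i
    using that inj by (simp add: w_def)
  define L where "L a b = (if a \<in> z ` {..<m} \<and> b \<in> z ` {..<m} then K (w a) (w b) else 0)" for a b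
  have w_mono: "strict_mono_on {..<n} (w \<circ> x)" "(w \<circ> x) ` {..<n} \<subseteq> {..<m}"
    if "strict_mono_on {..<n} x" "x ` {..<n} \<subseteq> z ` {..<m}" for n and x :: "nat \<Rightarrow> 'a"
  proof -
    have *: "w (x i) < m \<and> z (w (x i)) = x i" if "i < n" for i
      using that \<open>x ` {..<n} \<subseteq> z ` {..<m}\<close> wz by fastforce
    then show "(w \<circ> x) ` {..<n} \<subseteq> {..<m}" by auto
    show "strict_mono_on {..<n} (w \<circ> x)"
    proof (intro strict_mono_onI)
      fix i j :: nat assume "i \<in> {..<n}" "j \<in> {..<n}" "i < j"
      then have "z (w (x i)) < z (w (x j))"
        using * that(1) by (auto simp: strict_mono_on_def)
      then show "(w \<circ> x) i < (w \<circ> x) j"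
        using strict_mono_on_less[OF z, of "w (x i)" "w (x j)"] * \<open>i \<in> _\<close> \<open>j \<in> _\<close> by auto
    qed
  qed
  have "TN_kernel_on p X L"
    unfolding TN_kernel_on_def
  proof (intro allI impI, elim conjE)
    fix n :: nat and x y :: "nat \<Rightarrow> 'a"
    assume n: "1 \<le> n" "n \<le> p"
      and x: "strict_mono_on {..<n} x" "x ` {..<n} \<subseteq> X"
      and y: "strict_mono_on {..<n} y" "y ` {..<n} \<subseteq> X"
    consider (row) k where "k < n" "x k \<notin> z ` {..<m}" | (col) k where "k < n" "y k \<notin> z ` {..<m}"
      | (inside) "x ` {..<n} \<subseteq> z ` {..<m}" "y ` {..<n} \<subseteq> z ` {..<m}" by blast
    then show "0 \<le> det (mat n n (\<lambda>(i, j). L (x i) (y j)))"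
    proof cases
      case row
      then show ?thesis by (subst det_mat_zero_row[of k]) (auto simp: L_def)
    next
      case col
      then show ?thesis
        by (subst det_mat_transpose[symmetric], subst det_mat_zero_row[of k]) (auto simp: L_def)
    next
      case inside
      have "mat n n (\<lambda>(i, j). L (x i) (y j)) = mat n n (\<lambda>(i, j). K ((w \<circ> x) i) ((w \<circ> y) j))"
        using inside by (intro eq_matI) (auto simp: L_def image_subset_iff)
      then show ?thesis
        using TN_kernel_onD[OF tn n w_mono[OF x(1) inside(1)] w_mono[OF y(1) inside(2)]] by simp
    qed
  qed
  moreover have "sym_kernel_on X L"
    using sym unfolding sym_kernel_on_def L_def by (auto simp: wz)
  ultimately have FL: "TN_kernel_on p X (\<lambda>a b. F (L a b))"
    using pres unfolding preserves_TN_sym_kernel_def by blast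
  show ?thesis
    unfolding TN_kernel_on_def
  proof (intro allI impI, elim conjE)
    fix n :: nat and x y :: "nat \<Rightarrow> nat"
    assume n: "1 \<le> n" "n \<le> p"
      and x: "strict_mono_on {..<n} x" "x ` {..<n} \<subseteq> {..<m}"
      and y: "strict_mono_on {..<n} y" "y ` {..<n} \<subseteq> {..<m}"
    have zm: "strict_mono_on {..<n} (z \<circ> x)" "(z \<circ> x) ` {..<n} \<subseteq> X"
      if "strict_mono_on {..<n} x" "x ` {..<n} \<subseteq> {..<m}" for x
      using that z zX unfolding strict_mono_on_def by (auto simp: image_subset_iff)
    have "mat n n (\<lambda>(i, j). F (L ((z \<circ> x) i) ((z \<circ> y) j))) = mat n n (\<lambda>(i, j). F (K (x i) (y j)))"
      using x y by (intro eq_matI) (auto simp: L_def wz image_subset_iff)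
    then show "0 \<le> det (mat n n (\<lambda>(i, j). F (K (x i) (y j))))"
      using TN_kernel_onD[OF FL n zm[OF x] zm[OF y]] by simp
  qed
qed

section \<open>Criteria for total nonnegativity\<close>

text \<open>Sizes up to 3 are spelled out as polynomial inequalities. Larger sizes stay
  determinants, because wherever the rule is applied they vanish by low rank, exceed the chain, or
  exceed \<open>p\<close>.\<close>

lemma TN_kernel_onI:
  assumes one: "\<And>a b. a \<in> X \<Longrightarrow> b \<in> X \<Longrightarrow> 0 \<le> K a b"
    and two: "\<And>a b c d. \<lbrakk>2 \<le> p; {a, b, c, d} \<subseteq> X; a < b; c < d\<rbrakk> \<Longrightarrow> K a d * K b c \<le> K a c * K b d"
    and three: "\<And>a b c d e f. \<lbrakk>3 \<le> p; {a, b, c, d, e, f} \<subseteq> X; a < b; b < c; d < e; e < f\<rbrakk>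
      \<Longrightarrow> 0 \<le> K a d * (K b e * K c f - K b f * K c e) - K a e * (K b d * K c f - K b f * K c d)
              + K a f * (K b d * K c e - K b e * K c d)"
    and four: "\<And>n x y. \<lbrakk>4 \<le> n; n \<le> p; strict_mono_on {..<n} x; x ` {..<n} \<subseteq> X;
        strict_mono_on {..<n} y; y ` {..<n} \<subseteq> X\<rbrakk>
      \<Longrightarrow> 0 \<le> det (mat n n (\<lambda>(i, j). K (x i) (y j)))"
  shows "TN_kernel_on p X K"
  unfolding TN_kernel_on_def
proof (intro allI impI, elim conjE)
  fix n :: nat and x y :: "nat \<Rightarrow> 'a"
  assume n: "1 \<le> n" "n \<le> p"
    and x: "strict_mono_on {..<n} x" "x ` {..<n} \<subseteq> X"
    and y: "strict_mono_on {..<n} y" "y ` {..<n} \<subseteq> X"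
  have mono: "x i < x j" "y i < y j" if "i < j" "j < n" for i j
    using that x y by (auto simp: strict_mono_on_def)
  have mem: "x i \<in> X" "y i \<in> X" if "i < n" for i using that x y by auto
  consider "n = 1" | "n = 2" | "n = 3" | "4 \<le> n" using n by linarith
  then show "0 \<le> det (mat n n (\<lambda>(i, j). K (x i) (y j)))"
  proof cases
    case 1
    then show ?thesis using one mem by (simp only: det_mat_1)
  next
    case 2
    then show ?thesis
      using two[of "x 0" "x 1" "y 0" "y 1"] mono[of 0 1] mem[of 0] mem[of 1] n by (simp add: det_mat_2)
  next
    case 3
    then show ?thesis
      using three[of "x 0" "x 1" "x 2" "y 0" "y 1" "y 2"] mono[of 0 1] mono[of 1 2]
        mem[of 0] mem[of 1] mem[of 2] n by (simp add: det_mat_3)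
  next
    case 4
    then show ?thesis using four n x y by blast
  qed
qed

text \<open>All minors of size 2 or more vanish. Besides serving as test inputs, these kernels
  include the nonnegative constants.\<close>

lemma TN_kernel_on_rank1:
  assumes "\<And>i. i \<in> X \<Longrightarrow> 0 \<le> u i"
  shows "TN_kernel_on p X (\<lambda>i j. u i * u j)"
proof (rule TN_kernel_onI)
  fix n :: nat and x y :: "nat \<Rightarrow> 'a" assume "4 \<le> n"
  then show "0 \<le> det (mat n n (\<lambda>(i, j). u (x i) * u (y j)))"
    using det_mat_low_rank[of 1 n "\<lambda>_ i. u (x i)" "\<lambda>_ j. u (y j)"] by simp
qed (use assms in \<open>auto simp: algebra_simps\<close>)

lemma strict_mono_on_lessThan_le:
  fixes x :: "nat \<Rightarrow> nat"
  assumes "strict_mono_on {..<n} x" "x ` {..<n} \<subseteq> {..<m}"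
  shows "n \<le> m"
  using card_mono[OF _ assms(2)] card_image[OF strict_mono_on_imp_inj_on[OF assms(1)]] by simp

text \<open>On at most three points there is at most one 3 x 3 minor and none larger.\<close>

lemma TN_kernel_on_lessThanI:
  fixes K :: "nat \<Rightarrow> nat \<Rightarrow> real"
  assumes m: "m \<le> 3"
    and one: "\<And>a b. a < m \<Longrightarrow> b < m \<Longrightarrow> 0 \<le> K a b"
    and two: "\<And>a b c d. \<lbrakk>a < b; b < m; c < d; d < m\<rbrakk> \<Longrightarrow> K a d * K b c \<le> K a c * K b d"
    and three: "m = 3 \<Longrightarrow> 0 \<le> K 0 0 * (K 1 1 * K 2 2 - K 1 2 * K 2 1)
      - K 0 1 * (K 1 0 * K 2 2 - K 1 2 * K 2 0) + K 0 2 * (K 1 0 * K 2 1 - K 1 1 * K 2 0)"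
  shows "TN_kernel_on p {..<m} K"
proof (rule TN_kernel_onI)
  fix a b c d e f :: nat
  assume "{a, b, c, d, e, f} \<subseteq> {..<m}" "a < b" "b < c" "d < e" "e < f"
  with m have "m = 3" "a = 0" "b = 1" "c = 2" "d = 0" "e = 1" "f = 2" by auto
  with three show "0 \<le> K a d * (K b e * K c f - K b f * K c e)
    - K a e * (K b d * K c f - K b f * K c d) + K a f * (K b d * K c e - K b e * K c d)"
    by simp
next
  fix n :: nat and x y :: "nat \<Rightarrow> nat"
  assume "4 \<le> n" "strict_mono_on {..<n} x" "x ` {..<n} \<subseteq> {..<m}"
  with m have False using strict_mono_on_lessThan_le[of n x m] by simp
  then show "0 \<le> det (mat n n (\<lambda>(i, j). K (x i) (y j)))" ..
qed (use one two in auto)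

section \<open>Entrywise powers of 3 x 3 matrices\<close>

text \<open>By convexity, the slope of the secant of the power function between a point and 1 grows
  with that point; the denominators are cleared here.\<close>

lemma powr_secant_to_1:
  fixes u w \<alpha> :: real
  assumes "1 \<le> \<alpha>" "0 \<le> w" "w \<le> u" "u < 1"
  shows "(1 - u) * (1 - w powr \<alpha>) \<le> (1 - w) * (1 - u powr \<alpha>)"
proof (cases "w = 0")
  case True
  have "u powr \<alpha> \<le> u powr 1" if "u \<noteq> 0"
    using assms that True by (intro powr_mono') auto
  then have "u powr \<alpha> \<le> u" using assms by (cases "u = 0") auto
  then show ?thesis using True assms by auto
next
  case False
  \<comment> \<open>The weight with \<open>u = (1 - t) * w + t * 1\<close>, at which convexity is
    applied.\<close>
  define t where "t = (u - w) / (1 - w)"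
  have t: "0 \<le> t" "t \<le> 1" "(1 - w) * t = u - w"
    using assms by (auto simp: t_def)
  then have t': "(1 - t) * w + t = u" "(1 - w) * (1 - t) = 1 - u"
    by (auto simp: algebra_simps)
  have "((1 - t) *\<^sub>R w + t *\<^sub>R 1) powr \<alpha> \<le> (1 - t) * w powr \<alpha> + t * 1 powr \<alpha>"
    using t False assms by (intro convex_onD[OF powr_convex]) auto
  then have "u powr \<alpha> \<le> (1 - t) * w powr \<alpha> + t" using t' by simp
  then have "(1 - w) * u powr \<alpha> \<le> (1 - w) * ((1 - t) * w powr \<alpha> + t)"
    using assms by (intro mult_left_mono) auto
  also have "\<dots> = (1 - u) * w powr \<alpha> + (u - w)"
    using t t' by (simp add: distrib_left flip: mult.assoc)
  finally show ?thesis by (simp add: algebra_simps)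
qed

text \<open>This is the monotonicity of a quotient, with denominators cleared. In terms of
  \<open>w = f / Y\<close> and \<open>u = 1 / x\<close>, the sign condition on its derivative
  becomes the secant inequality for \<open>w \<le> u\<close>.\<close>

lemma powr_increment_ratio_mono:
  fixes \<alpha> f k v v' :: real
  assumes \<alpha>: "1 \<le> \<alpha>" and fk: "0 \<le> f" "f \<le> k" "0 < k" and v: "0 < v" "v \<le> v'"
  shows "((f + k * v) powr \<alpha> - f powr \<alpha>) * ((1 + v') powr \<alpha> - 1)
       \<le> ((f + k * v') powr \<alpha> - f powr \<alpha>) * ((1 + v) powr \<alpha> - 1)"
proof -
  let ?N = "\<lambda>v. (f + k * v) powr \<alpha> - f powr \<alpha>" and ?D = "\<lambda>v. (1 + v) powr \<alpha> - 1"
  have D: "?D s > 0" if "0 < s" for s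
    using powr_less_mono2[of \<alpha> 1 "1 + s"] \<alpha> that by simp
  have le: "?N v / ?D v \<le> ?N v' / ?D v'"
  proof (rule DERIV_nonneg_imp_nondecreasing[OF v(2)])
    fix s assume "v \<le> s" "s \<le> v'"
    with v have s: "0 < s" by simp
    define Y where "Y = f + k * s"
    define x where "x = 1 + s"
    have pos: "0 < Y" "0 < x" using s fk by (auto simp: Y_def x_def add_nonneg_pos)
    define w where "w = f / Y"
    define u where "u = 1 / x"
    \<comment> \<open>The hypothesis \<open>f \<le> k\<close> enters here, as
      \<open>Y - f * x = (k - f) * s\<close>.\<close>
    have "f * x \<le> Y" using fk s by (simp add: Y_def x_def distrib_left mult_right_mono)
    then have "w \<le> u" using pos by (simp add: w_def u_def field_simps)
    have u: "u < 1" "0 \<le> w" using s fk pos by (auto simp: u_def x_def w_def)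
    have Yw: "f powr \<alpha> = Y powr \<alpha> * w powr \<alpha>" and xu: "1 = x powr \<alpha> * u powr \<alpha>"
      using pos by (simp_all add: w_def u_def flip: powr_mult)
    have e: "Y powr \<alpha> = Y * Y powr (\<alpha> - 1)" "x powr \<alpha> = x * x powr (\<alpha> - 1)"
      using pos by (simp_all add: powr_mult_base)
    have "Y * ((1 - u) * (1 - w powr \<alpha>)) \<le> Y * ((1 - w) * (1 - u powr \<alpha>))"
      using powr_secant_to_1[OF \<alpha> u(2) \<open>w \<le> u\<close> u(1)] pos by (intro mult_left_mono) auto
    \<comment> \<open>Both sides equal \<open>k * s\<close>; this makes \<open>1 - u\<close> a
      common factor that can be cancelled.\<close>
    also have "Y * (1 - w) = k * (x * (1 - u))"
      using pos by (simp add: w_def u_def right_diff_distrib) (simp add: Y_def x_def algebra_simps)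
    then have "Y * ((1 - w) * (1 - u powr \<alpha>)) = k * (x * (1 - u)) * (1 - u powr \<alpha>)"
      by (simp only: mult.assoc[symmetric])
    finally have "Y * (1 - w powr \<alpha>) * (1 - u) \<le> k * x * (1 - u powr \<alpha>) * (1 - u)"
      by (simp add: mult_ac)
    then have "Y * (1 - w powr \<alpha>) \<le> k * x * (1 - u powr \<alpha>)"
      using u by (simp add: mult_le_cancel_right)
    \<comment> \<open>Multiplying by these powers restores \<open>?N s\<close> and
      \<open>?D s\<close>; the result is the inequality required by the quotient rule, up to the
      factor \<alpha>.\<close>
    then have "Y powr (\<alpha> - 1) * x powr (\<alpha> - 1) * (Y * (1 - w powr \<alpha>))
      \<le> Y powr (\<alpha> - 1) * x powr (\<alpha> - 1) * (k * x * (1 - u powr \<alpha>))"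
      by (intro mult_left_mono) auto
    then have "(Y powr \<alpha> - Y powr \<alpha> * w powr \<alpha>) * x powr (\<alpha> - 1)
        \<le> k * Y powr (\<alpha> - 1) * (x powr \<alpha> - x powr \<alpha> * u powr \<alpha>)"
      by (simp add: e algebra_simps)
    then have le: "?N s * x powr (\<alpha> - 1) \<le> k * Y powr (\<alpha> - 1) * ?D s"
      using Yw xu by (simp add: Y_def x_def)
    have "(?N has_real_derivative \<alpha> * Y powr (\<alpha> - 1) * k) (at s)"
      using pos unfolding Y_def by (auto intro!: derivative_eq_intros)
    moreover have "(?D has_real_derivative \<alpha> * x powr (\<alpha> - 1)) (at s)"
      using pos unfolding x_def by (auto intro!: derivative_eq_intros)
    ultimately have "((\<lambda>s. ?N s / ?D s) has_real_derivative
        ((\<alpha> * Y powr (\<alpha> - 1) * k) * ?D s - ?N s * (\<alpha> * x powr (\<alpha> - 1))) / (?D s * ?D s)) (at s)"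
      using D[OF s] by (intro DERIV_divide) simp_all
    moreover have "0 \<le> ((\<alpha> * Y powr (\<alpha> - 1) * k) * ?D s - ?N s * (\<alpha> * x powr (\<alpha> - 1))) / (?D s * ?D s)"
    proof (intro divide_nonneg_nonneg)
      have "0 \<le> \<alpha> * (k * Y powr (\<alpha> - 1) * ?D s - ?N s * x powr (\<alpha> - 1))"
        using le \<alpha> by simp
      then show "0 \<le> \<alpha> * Y powr (\<alpha> - 1) * k * ?D s - ?N s * (\<alpha> * x powr (\<alpha> - 1))"
        by (simp only: right_diff_distrib mult_ac)
    qed simp
    ultimately show "\<exists>y. ((\<lambda>s. ?N s / ?D s) has_real_derivative y) (at s) \<and> 0 \<le> y" by blast
  qed
  have "x * q \<le> y * p" if "x / p \<le> y / q" "0 < p" "0 < q" for x y p q :: real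
    using that by (simp add: field_simps)
  from this[OF le D D] show ?thesis using v by simp
qed

text \<open>The derivative is \<alpha> times an increment of the power with exponent
  \<open>\<alpha> - 1\<close>, which is nonnegative. It is computed in the open interval only, since
  \<open>s\<close> may be 0; at the endpoints continuity is enough.\<close>

lemma powr_increment_mono:
  fixes \<alpha> s t h :: real
  assumes \<alpha>: "1 \<le> \<alpha>" and st: "0 \<le> s" "s \<le> t" and h: "0 \<le> h"
  shows "(s + h) powr \<alpha> - s powr \<alpha> \<le> (t + h) powr \<alpha> - t powr \<alpha>"
proof (rule DERIV_nonneg_imp_increasing_open[OF st(2)])
  fix x assume "s < x" "x < t"
  with st have x: "0 < x" by simp
  have "((\<lambda>x. (x + h) powr \<alpha> - x powr \<alpha>) has_real_derivative
      \<alpha> * (x + h) powr (\<alpha> - 1) - \<alpha> * x powr (\<alpha> - 1)) (at x)"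
    using x h by (auto intro!: derivative_eq_intros)
  moreover have "0 \<le> \<alpha> * (x + h) powr (\<alpha> - 1) - \<alpha> * x powr (\<alpha> - 1)"
    using x h \<alpha> by (auto intro!: mult_left_mono powr_mono2)
  ultimately show "\<exists>y. ((\<lambda>x. (x + h) powr \<alpha> - x powr \<alpha>) has_real_derivative y) (at x) \<and> 0 \<le> y"
    by blast
next
  show "continuous_on {s..t} (\<lambda>x. (x + h) powr \<alpha> - x powr \<alpha>)"
    using \<alpha> st h by (auto intro!: continuous_intros continuous_on_powr')
qed

text \<open>The matrix here is \<open>[[1, 1, f], [1, a, b], [e, c, d]]\<close>.\<close>
lemma powr_minor3_normalized:
  fixes \<alpha> a b c d e f :: real
  assumes \<alpha>: "1 \<le> \<alpha>" and nn: "0 \<le> e" "0 \<le> f" and a: "1 \<le> a" and b: "f * a \<le> b"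
    and c: "e * a \<le> c" and d: "e * f \<le> d"
    and det: "(b - f) * (c - e) \<le> (a - 1) * (d - e * f)"
  shows "(b powr \<alpha> - f powr \<alpha>) * (c powr \<alpha> - e powr \<alpha>)
    \<le> (a powr \<alpha> - 1) * (d powr \<alpha> - (e * f) powr \<alpha>)"
proof -
  have a': "0 \<le> a powr \<alpha> - 1" using powr_mono2[of \<alpha> 1 a] a \<alpha> by simp
  have d': "0 \<le> d powr \<alpha> - (e * f) powr \<alpha>" using powr_mono2[of \<alpha> "e * f" d] nn d \<alpha> by simp
  have fa: "f \<le> f * a" "e \<le> e * a" using a nn by (simp_all add: mult_le_cancel_left1)
  show ?thesis
  proof (cases "(b - f) * (c - e) = 0")
    case True
    then have "(b powr \<alpha> - f powr \<alpha>) * (c powr \<alpha> - e powr \<alpha>) = 0" by auto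
    then show ?thesis using mult_nonneg_nonneg[OF a' d'] by linarith
  next
    case False
    then have pos: "0 < b - f" "0 < c - e" using b c fa by auto
    then have "a \<noteq> 1" using det by (auto simp: mult_le_0_iff)
    then have a1: "0 < a - 1" using a by simp
    \<comment> \<open>With \<open>b = f + k * (a - 1)\<close>, the bound
      \<open>f * a \<le> b\<close> says \<open>f \<le> k\<close>, and the determinant condition says
      that \<open>d\<close> is at least \<open>e * f + k * (c - e)\<close>. The right side of the
      claim grows with \<open>d\<close>, so this extreme value suffices.\<close>
    define k where "k = (b - f) / (a - 1)"
    have k: "0 < k" "f \<le> k" "b = f + k * (a - 1)"
      using pos a1 b by (auto simp: k_def field_simps)
    have "k * (c - e) \<le> d - e * f"
      using det a1 by (simp add: k_def field_simps)
    then have d_ge: "e * f + k * (c - e) \<le> d" by simp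
    have kc: "0 \<le> k * (c - e)" using k pos by simp
    then have d2: "(e * f + k * (c - e)) powr \<alpha> \<le> d powr \<alpha>"
      using d_ge nn \<alpha> by (intro powr_mono2) auto
    have "(b powr \<alpha> - f powr \<alpha>) * (c powr \<alpha> - e powr \<alpha>)
      \<le> (a powr \<alpha> - 1) * ((e * f + k * (c - e)) powr \<alpha> - (e * f) powr \<alpha>)"
    \<comment> \<open>For \<open>e > 0\<close>, dividing by the power of \<open>e\<close> leaves the
      ratio inequality for \<open>a - 1 \<le> c / e - 1\<close>. For \<open>e = 0\<close> its
      limiting form is used: increments of length \<open>k * (a - 1)\<close> grow from the starting
      point \<open>f\<close> to \<open>k\<close>.\<close>
    proof (cases "e = 0")
      case True
      have "b powr \<alpha> - f powr \<alpha> \<le> (k + k * (a - 1)) powr \<alpha> - k powr \<alpha>"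
        unfolding k(3) using k a1 nn by (intro powr_increment_mono[OF \<alpha>]) auto
      also have "k + k * (a - 1) = k * a" by (simp add: algebra_simps)
      finally have "(b powr \<alpha> - f powr \<alpha>) * c powr \<alpha> \<le> ((k * a) powr \<alpha> - k powr \<alpha>) * c powr \<alpha>"
        by (intro mult_right_mono) auto
      then show ?thesis using True by (simp add: powr_mult algebra_simps)
    next
      case False
      then have e: "0 < e" using nn by simp
      define c' where "c' = c / e"
      have c': "c = e * c'" "a \<le> c'" using e c by (auto simp: c'_def field_simps)
      have "(b powr \<alpha> - f powr \<alpha>) * (c' powr \<alpha> - 1)
        \<le> ((f + k * (c' - 1)) powr \<alpha> - f powr \<alpha>) * (a powr \<alpha> - 1)"
        using powr_increment_ratio_mono[OF \<alpha> nn(2) k(2,1) a1, of "c' - 1"] c' k(3) by simp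
      then have "e powr \<alpha> * ((b powr \<alpha> - f powr \<alpha>) * (c' powr \<alpha> - 1))
        \<le> e powr \<alpha> * (((f + k * (c' - 1)) powr \<alpha> - f powr \<alpha>) * (a powr \<alpha> - 1))"
        by (intro mult_left_mono) auto
      moreover have "e * f + k * (c - e) = e * (f + k * (c' - 1))"
        by (simp add: c' algebra_simps)
      then have "(e * f + k * (c - e)) powr \<alpha> = e powr \<alpha> * (f + k * (c' - 1)) powr \<alpha>"
        by (simp only: powr_mult)
      moreover have "c powr \<alpha> = e powr \<alpha> * c' powr \<alpha>" "(e * f) powr \<alpha> = e powr \<alpha> * f powr \<alpha>"
        by (simp_all only: c' powr_mult)
      ultimately show ?thesis by (simp add: algebra_simps)
    qed
    also have "\<dots> \<le> (a powr \<alpha> - 1) * (d powr \<alpha> - (e * f) powr \<alpha>)"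
      using a' d2 by (intro mult_left_mono) auto
    finally show ?thesis .
  qed
qed

text \<open>The rows are \<open>(a, b, c)\<close>, \<open>(d, e, f)\<close>,
  \<open>(g, h, i)\<close>. If \<open>a\<close>, \<open>b\<close>, \<open>d\<close> are positive,
  dividing the first row by \<open>a\<close> and the second by \<open>d\<close> and multiplying the
  second column by \<open>a / b\<close> gives the normal form. If one of them is 0, the 2 x 2
  conditions give a zero row or column, or reduce the determinant to \<open>a\<close> times a 2 x 2
  minor.\<close>

lemma powr_minor3_nonneg:
  fixes \<alpha> a b c d e f g h i :: real
  assumes \<alpha>: "1 \<le> \<alpha>"
    and nn: "0 \<le> a" "0 \<le> b" "0 \<le> c" "0 \<le> d" "0 \<le> e" "0 \<le> f" "0 \<le> g" "0 \<le> h" "0 \<le> i"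
    and m: "b * d \<le> a * e" "c * d \<le> a * f" "c * e \<le> b * f" "b * g \<le> a * h" "c * g \<le> a * i"
      "c * h \<le> b * i" "e * g \<le> d * h" "f * g \<le> d * i" "f * h \<le> e * i"
    and det: "0 \<le> a * (e * i - f * h) - b * (d * i - f * g) + c * (d * h - e * g)"
  shows "0 \<le> a powr \<alpha> * (e powr \<alpha> * i powr \<alpha> - f powr \<alpha> * h powr \<alpha>)
    - b powr \<alpha> * (d powr \<alpha> * i powr \<alpha> - f powr \<alpha> * g powr \<alpha>)
    + c powr \<alpha> * (d powr \<alpha> * h powr \<alpha> - e powr \<alpha> * g powr \<alpha>)"
proof -
  have z: "x = 0 \<or> y = 0" if "x * y \<le> 0" "0 \<le> x" "0 \<le> y" for x y :: real
    using that by (auto simp: mult_le_0_iff)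
  have sub: "0 \<le> a powr \<alpha> * (e powr \<alpha> * i powr \<alpha> - f powr \<alpha> * h powr \<alpha>)"
    using powr_mono2[of \<alpha> "f * h" "e * i"] \<alpha> m nn by (simp add: powr_mult)
  consider (zero) "a = 0" "b = 0 \<and> c = 0 \<or> d = 0 \<and> g = 0"
    | (b) "b = 0" "c = 0 \<or> e = 0 \<and> h = 0" | (d) "d = 0" "g = 0 \<or> e = 0 \<and> f = 0"
    | (pos) "0 < a" "0 < b" "0 < d"
  proof (cases "a = 0 \<or> b = 0 \<or> d = 0")
    case True
    then show ?thesis
    proof (elim disjE)
      assume "a = 0"
      have "(b = 0 \<or> d = 0) \<and> (b = 0 \<or> g = 0) \<and> (c = 0 \<or> d = 0) \<and> (c = 0 \<or> g = 0)"
        using m(1,2,4,5) nn unfolding \<open>a = 0\<close> by (intro conjI z) auto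
      then show ?thesis using zero \<open>a = 0\<close> by auto
    next
      assume "b = 0"
      have "(c = 0 \<or> e = 0) \<and> (c = 0 \<or> h = 0)"
        using m(3,6) nn unfolding \<open>b = 0\<close> by (intro conjI z) auto
      then show ?thesis using b \<open>b = 0\<close> by auto
    next
      assume "d = 0"
      have "(e = 0 \<or> g = 0) \<and> (f = 0 \<or> g = 0)"
        using m(7,8) nn unfolding \<open>d = 0\<close> by (intro conjI z) auto
      then show ?thesis using d \<open>d = 0\<close> by auto
    qed
  next
    case False
    then show ?thesis using nn by (intro pos) auto
  qed
  then show ?thesis
  proof cases
    case pos
    \<comment> \<open>This identity is used for the entries and again for their powers: its
      hypotheses are multiplicative and survive taking powers.\<close>
    have scale: "a * (e * i - f * h) - b * (d * i - f * g) + c * (d * h - e * g)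
        = b * d * ((A - 1) * (i - g * E) - (B - E) * (C - g))"
      if "a * e = b * d * A" "f = d * B" "a * h = b * C" "c = a * E"
      for a b c d e f g h i A B C E :: real
    proof -
      have "a * (e * i - f * h) - b * (d * i - f * g) + c * (d * h - e * g)
          = (a * e) * (i - g * E) - f * (a * h) - b * d * i + b * f * g + E * d * (a * h)"
        by (simp add: that(4) algebra_simps)
      then show ?thesis unfolding that(1-3) by (simp add: algebra_simps)
    qed
    define A B C E where "A = a * e / (b * d)" and "B = f / d" and "C = a * h / b" and "E = c / a"
    have eqs: "a * e = b * d * A" "f = d * B" "a * h = b * C" "c = a * E"
      using pos by (simp_all add: A_def B_def C_def E_def)
    have "0 \<le> b * d * ((A - 1) * (i - g * E) - (B - E) * (C - g))"
      using det unfolding scale[OF eqs] .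
    moreover have bd: "0 < b * d" using pos by simp
    ultimately have "0 \<le> (A - 1) * (i - g * E) - (B - E) * (C - g)"
      by (simp only: zero_le_mult_iff) linarith
    moreover have "1 \<le> A" "g * A \<le> C" "g * E \<le> i" "0 \<le> E"
      using pos m nn by (simp_all add: A_def C_def E_def pos_divide_le_eq pos_le_divide_eq mult_ac)
    moreover have "E * A \<le> B"
    proof -
      have "E * A = c * e / (b * d)" using pos by (simp add: A_def E_def)
      also have "\<dots> \<le> b * f / (b * d)" using m bd by (intro divide_right_mono) auto
      also have "\<dots> = B" using pos by (simp add: B_def)
      finally show ?thesis .
    qed
    ultimately have "(B powr \<alpha> - E powr \<alpha>) * (C powr \<alpha> - g powr \<alpha>)
      \<le> (A powr \<alpha> - 1) * (i powr \<alpha> - (g * E) powr \<alpha>)"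
      using nn by (intro powr_minor3_normalized[OF \<alpha>]) auto
    then have "0 \<le> b powr \<alpha> * d powr \<alpha> * ((A powr \<alpha> - 1) * (i powr \<alpha> - g powr \<alpha> * E powr \<alpha>)
        - (B powr \<alpha> - E powr \<alpha>) * (C powr \<alpha> - g powr \<alpha>))"
      by (simp add: powr_mult)
    also have "\<dots> = a powr \<alpha> * (e powr \<alpha> * i powr \<alpha> - f powr \<alpha> * h powr \<alpha>)
      - b powr \<alpha> * (d powr \<alpha> * i powr \<alpha> - f powr \<alpha> * g powr \<alpha>)
      + c powr \<alpha> * (d powr \<alpha> * h powr \<alpha> - e powr \<alpha> * g powr \<alpha>)"
      by (intro scale[symmetric]) (simp_all only: eqs flip: powr_mult)
    finally show ?thesis .
  qed (use sub in auto)
qed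

section \<open>Monotone multiplicative functions\<close>

text \<open>\<open>L\<close> is homogeneous over the integers. Squeezing \<open>n * x\<close>
  between consecutive integers bounds \<open>n\<close> times the error by \<open>L 1\<close> for
  every \<open>n\<close>, so the error is 0.\<close>

lemma additive_mono_imp_linear:
  fixes L :: "real \<Rightarrow> real"
  assumes add: "\<And>x y. L (x + y) = L x + L y" and mono: "mono L"
  shows "L x = L 1 * x"
proof -
  interpret additive L by (unfold_locales) (rule add)
  have nat: "L (of_nat n * y) = of_nat n * L y" for n y
    by (induction n) (simp_all add: zero add distrib_right)
  have int: "L (of_int m * y) = of_int m * L y" for m y
  proof (cases "0 \<le> m")
    case True
    then show ?thesis using nat[of "nat m" y] by simp
  next
    case False
    then show ?thesis using nat[of "nat (- m)" y] minus[of "of_int (- m) * y"] by simp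
  qed
  have L1: "0 \<le> L 1" using monoD[OF mono, of 0 1] by (simp add: zero)
  have bound: "real n * \<bar>L x - L 1 * x\<bar> \<le> L 1" for n
  proof -
    define m where "m = \<lfloor>real n * x\<rfloor>"
    have m: "of_int m \<le> real n * x" "real n * x \<le> of_int (m + 1)"
      unfolding m_def by linarith+
    have "of_int m * L 1 \<le> real n * L x" "real n * L x \<le> of_int (m + 1) * L 1"
      using monoD[OF mono m(1)] monoD[OF mono m(2)] int[of m 1] int[of "m + 1" 1] nat[of n x] by simp_all
    moreover have "of_int m * L 1 \<le> real n * x * L 1" "real n * x * L 1 \<le> of_int (m + 1) * L 1"
      using m L1 by (auto intro!: mult_right_mono)
    ultimately have "\<bar>real n * L x - real n * x * L 1\<bar> \<le> L 1"
      by (simp add: distrib_right)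
    then have "\<bar>real n * (L x - L 1 * x)\<bar> \<le> L 1" by (simp add: algebra_simps)
    then show ?thesis by (simp add: abs_mult)
  qed
  show ?thesis
  proof (rule ccontr)
    assume "L x \<noteq> L 1 * x"
    then have "0 < \<bar>L x - L 1 * x\<bar>" by simp
    from reals_Archimedean3[OF this] obtain n where "L 1 < real n * \<bar>L x - L 1 * x\<bar>" by blast
    with bound[of n] show False by simp
  qed
qed

text \<open>Conjugating \<open>g\<close> with \<open>exp\<close> and \<open>ln\<close> gives an
  additive monotone function, whose slope is the exponent.\<close>

lemma multiplicative_mono_imp_powr:
  fixes g :: "real \<Rightarrow> real"
  assumes mult: "\<And>x y. 0 < x \<Longrightarrow> 0 < y \<Longrightarrow> g (x * y) = g x * g y"
    and pos: "\<And>x. 0 < x \<Longrightarrow> 0 < g x"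
    and mono: "\<And>x y. 0 < x \<Longrightarrow> x \<le> y \<Longrightarrow> g x \<le> g y"
  obtains \<alpha> where "0 \<le> \<alpha>" "\<And>x. 0 < x \<Longrightarrow> g x = x powr \<alpha>"
proof -
  define L where "L s = ln (g (exp s))" for s
  have "L (s + t) = L s + L t" for s t
    using pos[of "exp s"] pos[of "exp t"] by (simp add: L_def exp_add mult ln_mult_pos)
  moreover have "mono L"
    by (intro monoI) (simp add: L_def pos mono)
  ultimately have L: "L s = L 1 * s" for s by (rule additive_mono_imp_linear)
  have "0 \<le> L 1" using monoD[OF \<open>mono L\<close>, of 0 1] L[of 0] by simp
  moreover have "g x = x powr L 1" if "0 < x" for x
  proof -
    have "g x = exp (L (ln x))" using that pos by (simp add: L_def)
    also have "\<dots> = x powr L 1" using that by (subst L) (simp add: powr_def)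
    finally show ?thesis .
  qed
  ultimately show ?thesis using that by blast
qed

text \<open>Special arguments turn \<open>rank1\<close> into the equation
  \<open>F (x * y) * F 1 = F x * F y\<close> for \<open>y > 0\<close>. A nonzero \<open>F 0\<close>
  makes \<open>F\<close> constant; if \<open>F 0 = 0\<close> and \<open>F 1\<close> is nonzero,
  exponent 0 yields the indicator.\<close>

lemma TN2_functional_equation_solution:
  fixes F :: "real \<Rightarrow> real"
  assumes nn: "\<And>x. 0 \<le> x \<Longrightarrow> 0 \<le> F x"
    and mono: "\<And>x y. 0 \<le> x \<Longrightarrow> x \<le> y \<Longrightarrow> F x \<le> F y"
    and rank1: "\<And>x y z. 0 \<le> x \<Longrightarrow> 0 \<le> y \<Longrightarrow> 0 \<le> z \<Longrightarrow> F (x * z) * F (y * y) \<le> F (x * y) * F (y * z)"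
  shows "(\<exists>c\<ge>0. \<forall>x\<ge>0. F x = c)
    \<or> (\<exists>c>0. \<exists>\<alpha>>0. \<forall>x\<ge>0. F x = c * x powr \<alpha>)
    \<or> (\<exists>c>0. \<forall>x\<ge>0. F x = (if x = 0 then 0 else c))"
proof -
  have le: "F x * F y \<le> F (x * y) * F 1" if "0 \<le> x" "0 < y" for x y
  proof -
    \<comment> \<open>The arguments \<open>x * sqrt y\<close>, \<open>sqrt y\<close>,
      \<open>1 / sqrt y\<close> are chosen so that the products in \<open>rank1\<close> become
      \<open>x\<close>, \<open>y\<close>, \<open>x * y\<close> and 1.\<close>
    have e: "x * sqrt y * (1 / sqrt y) = x" "sqrt y * sqrt y = y" "x * sqrt y * sqrt y = x * y"
      "sqrt y * (1 / sqrt y) = 1"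
      using that by (simp_all add: mult.assoc)
    have "F (x * sqrt y * (1 / sqrt y)) * F (sqrt y * sqrt y)
        \<le> F (x * sqrt y * sqrt y) * F (sqrt y * (1 / sqrt y))"
      using that by (intro rank1) auto
    then show ?thesis unfolding e .
  qed
  have ge: "F (x * y) * F 1 \<le> F x * F y" if "0 \<le> x" "0 \<le> y" for x y
    using rank1[of x 1 y] that by simp
  have eq: "F (x * y) * F 1 = F x * F y" if "0 \<le> x" "0 < y" for x y
    using le[OF that] ge[of x y] that by simp
  \<comment> \<open>Unless \<open>F 0 = 0\<close>, this gives \<open>F 1 \<le> F 0\<close>, the
    converse of monotonicity.\<close>
  have F0: "F 0 * F 1 \<le> F 0 * F 0"
    using rank1[of 1 0 1] by (simp add: mult.commute)
  have "F 0 = 0 \<or> F 0 = F 1"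
    using F0 nn[of 0] mono[of 0 1] by (auto simp: mult_le_cancel_left)
  show ?thesis
  proof (cases "F 0 = 0")
    case False
    then have pos: "F y = F 1" if "0 < y" for y
      using eq[of 0 y] that by simp
    have zero: "F 0 = F 1" using False \<open>F 0 = 0 \<or> F 0 = F 1\<close> by simp
    have "F x = F 1" if "0 \<le> x" for x
      using that zero pos[of x] by (cases "x = 0") simp_all
    then show ?thesis using nn[of 1] by (metis zero_le_one)
  next
    case F00: True
    show ?thesis
    proof (cases "F 1 = 0")
      case True
      then have "F x * F x = 0" if "0 < x" for x using eq[of x x] that by simp
      then have "\<forall>x\<ge>0. F x = 0" using F00 by (auto simp: order_le_less)
      then show ?thesis by auto
    next
      case False
      define c where "c = F 1"
      have c: "0 < c" using False nn[of 1] by (simp add: c_def)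
      have Fpos: "0 < F x" if "0 < x" for x
        using eq[of x "1 / x"] that c nn[of x] by (auto simp: c_def order_le_less)
      obtain \<alpha> where \<alpha>: "0 \<le> \<alpha>" "\<And>x. 0 < x \<Longrightarrow> F x / c = x powr \<alpha>"
      proof (rule multiplicative_mono_imp_powr[of "\<lambda>x. F x / c"])
        fix x y :: real assume "0 < x" "0 < y"
        then show "F (x * y) / c = F x / c * (F y / c)"
          using eq[of x y] c by (simp add: c_def field_simps)
      qed (use c Fpos mono in \<open>auto intro: divide_right_mono\<close>)
      have F: "F x = c * x powr \<alpha>" if "0 < x" for x
        using \<alpha>(2)[OF that] c by (simp add: field_simps)
      show ?thesis
      proof (cases "\<alpha> = 0")
        case True
        then have "\<forall>x\<ge>0. F x = (if x = 0 then 0 else c)" using F F00 by auto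
        then show ?thesis using c by blast
      next
        case False
        have "F x = c * x powr \<alpha>" if "0 \<le> x" for x
          using that F[of x] F00 by (cases "x = 0") auto
        moreover have "0 < \<alpha>" using False \<alpha> by simp
        ultimately show ?thesis using c by blast
      qed
    qed
  qed
qed

section \<open>A power expansion\<close>

text \<open>The expression is minus the minor, with rows 0..3 and columns 1..4, of the entrywise
  power of \<open>gram_kernel t\<close>. Its leading term is
  \<open>2 * \<alpha>^3 * (\<alpha> - 1) * t^4\<close>, positive because \<alpha> > 1.\<close>

lemma ex_powr_gram_minor_pos:
  fixes \<alpha> \<delta> :: real
  assumes "1 < \<alpha>" "0 < \<delta>"
  obtains t where "0 < t" "t < \<delta>"
    "((1 - t) powr \<alpha> - 1) * (((1 + 3 * t) powr \<alpha> - 1)\<^sup>2 + ((1 - 3 * t) powr \<alpha> - 1)\<^sup>2)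
     - 2 * ((1 + t) powr \<alpha> - 1) * ((1 + 3 * t) powr \<alpha> - 1) * ((1 - 3 * t) powr \<alpha> - 1)
     + ((1 - 8 * t) powr \<alpha> - 1) * (((1 + t) powr \<alpha> - 1)\<^sup>2 - ((1 - t) powr \<alpha> - 1)\<^sup>2) > 0"
proof -
  define od where "od t = ((1 + t) powr \<alpha> - (1 - t) powr \<alpha>) / 2" for t
  define ev where "ev t = ((1 + t) powr \<alpha> + (1 - t) powr \<alpha> - 2) / 2" for t
  define Z where "Z t = (1 - 8 * t) powr \<alpha> - 1" for t
  have od1: "((\<lambda>t. od t / t) \<longlongrightarrow> \<alpha>) (at_right 0)" and od3: "((\<lambda>t. od (3 * t) / t) \<longlongrightarrow> 3 * \<alpha>) (at_right 0)"
    unfolding od_def by real_asymp+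
  have ev1: "((\<lambda>t. ev t / t ^ 2) \<longlongrightarrow> \<alpha> * (\<alpha> - 1) / 2) (at_right 0)"
    and ev3: "((\<lambda>t. ev (3 * t) / t ^ 2) \<longlongrightarrow> 9 * \<alpha> * (\<alpha> - 1) / 2) (at_right 0)"
    unfolding ev_def by (real_asymp simp: field_simps)+
  have Z: "((\<lambda>t. Z t / t) \<longlongrightarrow> - 8 * \<alpha>) (at_right 0)"
    unfolding Z_def by real_asymp
  \<comment> \<open>In terms of the odd and even parts of \<open>(1 + t)\<^sup>\<alpha> - 1\<close>, the claim reads \<open>4 t od(t) ev(t) H(t) > 0\<close>.\<close>
  define H where "H t = (od (3 * t) / t)\<^sup>2 / (od t / t) - t * ((ev (3 * t) / t\<^sup>2)\<^sup>2 / (ev t / t\<^sup>2)) + Z t / t" for t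
  \<comment> \<open>The limit is \<open>9 * \<alpha> - 8 * \<alpha>\<close>: the 9 comes from the
    arguments \<open>3 * t\<close>, the 8 from \<open>1 - 8 * t\<close>, and the middle term carries
    an extra factor \<open>t\<close>.\<close>
  have "(H \<longlongrightarrow> (3 * \<alpha>)\<^sup>2 / \<alpha> - 0 * ((9 * \<alpha> * (\<alpha> - 1) / 2)\<^sup>2 / (\<alpha> * (\<alpha> - 1) / 2)) + - 8 * \<alpha>) (at_right 0)"
    unfolding H_def using assms by (intro tendsto_intros od1 od3 ev1 ev3 Z) auto
  also have "(3 * \<alpha>)\<^sup>2 / \<alpha> - 0 * ((9 * \<alpha> * (\<alpha> - 1) / 2)\<^sup>2 / (\<alpha> * (\<alpha> - 1) / 2)) + - 8 * \<alpha> = \<alpha>"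
    using assms by (simp add: power2_eq_square)
  finally have H: "(H \<longlongrightarrow> \<alpha>) (at_right 0)" .
  have "\<forall>\<^sub>F t in at_right 0. 0 < H t" "\<forall>\<^sub>F t in at_right 0. 0 < od t / t" "\<forall>\<^sub>F t in at_right 0. 0 < ev t / t\<^sup>2"
    "\<forall>\<^sub>F t in at_right 0. t < \<delta>" "\<forall>\<^sub>F t in at_right (0::real). 0 < t"
    using order_tendstoD(1)[OF H, of 0] order_tendstoD(1)[OF od1, of 0] order_tendstoD(1)[OF ev1, of 0] assms
      eventually_at_right_less[of "0::real"] by (auto simp: eventually_at_right intro!: exI[of _ \<delta>])
  then have "\<forall>\<^sub>F t in at_right 0. 0 < H t \<and> 0 < od t / t \<and> 0 < ev t / t\<^sup>2 \<and> t < \<delta> \<and> 0 < t"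
    by eventually_elim auto
  then obtain t where t: "0 < H t" "0 < od t / t" "0 < ev t / t\<^sup>2" "t < \<delta>" "0 < t"
    using eventually_happens[of _ "at_right (0::real)"] by (auto simp: trivial_limit_at_right_real)
  have pos: "0 < od t" "0 < ev t" using t by (simp_all add: zero_less_divide_iff)
  have "od t * ev t * (t * H t) = ev t * (od (3 * t))\<^sup>2 - od t * (ev (3 * t))\<^sup>2 + od t * ev t * Z t"
    using t pos unfolding H_def by (simp add: field_simps power2_eq_square)
  moreover have "0 < od t * ev t * (t * H t)" using t pos by simp
  ultimately have key: "0 < ev t * (od (3 * t))\<^sup>2 - od t * (ev (3 * t))\<^sup>2 + od t * ev t * Z t" by simp
  have e: "(1 + t) powr \<alpha> - 1 = ev t + od t" "(1 - t) powr \<alpha> - 1 = ev t - od t"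
    "(1 + 3 * t) powr \<alpha> - 1 = ev (3 * t) + od (3 * t)" "(1 - 3 * t) powr \<alpha> - 1 = ev (3 * t) - od (3 * t)"
    "(1 - 8 * t) powr \<alpha> - 1 = Z t"
    by (simp_all add: od_def ev_def Z_def field_simps)
  have "(x - y) * ((x' + y')\<^sup>2 + (x' - y')\<^sup>2) - 2 * (x + y) * (x' + y') * (x' - y') + z * ((x + y)\<^sup>2 - (x - y)\<^sup>2)
    = 4 * (x * y'\<^sup>2 - y * x'\<^sup>2 + y * x * z)" for x y x' y' z :: real
    by (simp add: power2_eq_square algebra_simps)
  then show ?thesis
    using key t by (intro that[of t]) (simp_all only: e mult_pos_pos zero_less_numeral)
qed

section \<open>Sufficiency\<close>

lemma rpow_eq_powr:
  assumes "0 < \<alpha>"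
  shows "rpow x \<alpha> = x powr \<alpha>"
  using assms by (simp add: rpow_def)

lemma rpow_mono_mult:
  assumes "0 \<le> \<alpha>" "0 \<le> x" "0 \<le> y" "0 \<le> z" "0 \<le> w" "x * y \<le> z * w"
  shows "rpow x \<alpha> * rpow y \<alpha> \<le> rpow z \<alpha> * rpow w \<alpha>"
  using assms powr_mono2[of \<alpha> "x * y" "z * w"] by (auto simp: rpow_def powr_mult)

lemma rpow_nonneg: "0 \<le> rpow x \<alpha>"
  by (simp add: rpow_def)

text \<open>Stated for arbitrary kernels, so that it serves matrices and kernels alike. For the
  indicator, a zero on the diagonal of a 2 x 2 block forces one on its antidiagonal; the linear case
  scales each minor by a power of \<open>c\<close>.\<close>

lemma TN_preserver_form_sufficient:
  assumes form: "TN_preserver_form p F" and "0 < p" and K: "TN_kernel_on p X K"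
  shows "TN_kernel_on p X (\<lambda>x y. F (K x y))"
proof -
  have nn: "0 \<le> K a b" if "a \<in> X" "b \<in> X" for a b
    using TN_kernel_on_entry[OF K] that \<open>0 < p\<close> by simp
  have m2: "K a d * K b c \<le> K a c * K b d" if "2 \<le> p" "{a, b, c, d} \<subseteq> X" "a < b" "c < d" for a b c d
    using TN_kernel_on_minor2[OF K] that by auto
  consider (const) c where "0 \<le> c" "\<And>x. 0 \<le> x \<Longrightarrow> F x = c"
    | (p1) "p = 1" "\<And>x. 0 \<le> x \<Longrightarrow> 0 \<le> F x"
    | (power) c \<alpha> where "p = 2" "0 < c" "0 \<le> \<alpha>" "\<And>x. 0 \<le> x \<Longrightarrow> F x = c * rpow x \<alpha>"
    | (ind) c where "p = 2" "0 < c" "\<And>x. 0 \<le> x \<Longrightarrow> F x = (if x = 0 then 0 else c)"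
    | (p3) c \<alpha> where "p = 3" "0 < c" "1 \<le> \<alpha>" "\<And>x. 0 \<le> x \<Longrightarrow> F x = c * rpow x \<alpha>"
    | (p4) c where "4 \<le> p" "0 < c" "\<And>x. 0 \<le> x \<Longrightarrow> F x = c * x"
    using form unfolding TN_preserver_form_def by blast
  then show ?thesis
  proof cases
    case const
    have "TN_kernel_on p X (\<lambda>x y. sqrt c * sqrt c)"
      using const by (intro TN_kernel_on_rank1) auto
    moreover have "TN_kernel_on p X (\<lambda>x y. F (K x y)) = TN_kernel_on p X (\<lambda>x y. sqrt c * sqrt c)"
      using const nn by (intro TN_kernel_on_cong) auto
    ultimately show ?thesis by simp
  next
    case p1
    then show ?thesis using nn by (intro TN_kernel_onI) auto
  next
    case power
    show ?thesis
    proof (rule TN_kernel_onI)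
      fix a b c' d assume *: "2 \<le> p" "{a, b, c', d} \<subseteq> X" "a < b" "c' < d"
      then have "rpow (K a d) \<alpha> * rpow (K b c') \<alpha> \<le> rpow (K a c') \<alpha> * rpow (K b d) \<alpha>"
        using nn m2 power by (intro rpow_mono_mult) auto
      then have "c * c * (rpow (K a d) \<alpha> * rpow (K b c') \<alpha>) \<le> c * c * (rpow (K a c') \<alpha> * rpow (K b d) \<alpha>)"
        using power by (intro mult_left_mono) auto
      then show "F (K a d) * F (K b c') \<le> F (K a c') * F (K b d)"
        using * nn power by (simp add: mult_ac)
    qed (use power nn in \<open>auto simp: rpow_nonneg\<close>)
  next
    case ind
    show ?thesis
    proof (rule TN_kernel_onI)
      fix a b c' d assume *: "2 \<le> p" "{a, b, c', d} \<subseteq> X" "a < b" "c' < d"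
      have "K a d = 0 \<or> K b c' = 0" if "K a c' = 0 \<or> K b d = 0"
        using m2[OF *] nn[of a d] nn[of b c'] * that by (auto simp: mult_le_0_iff)
      then show "F (K a d) * F (K b c') \<le> F (K a c') * F (K b d)"
        using * nn ind by auto
    qed (use ind nn in auto)
  next
    case p3
    have F: "F x = c * x powr \<alpha>" if "0 \<le> x" for x
      using p3 that by (simp add: rpow_eq_powr)
    show ?thesis
    proof (rule TN_kernel_onI)
      fix a b c' d assume *: "2 \<le> p" "{a, b, c', d} \<subseteq> X" "a < b" "c' < d"
      then have "rpow (K a d) \<alpha> * rpow (K b c') \<alpha> \<le> rpow (K a c') \<alpha> * rpow (K b d) \<alpha>"
        using nn m2 p3 by (intro rpow_mono_mult) auto
      then have "c * c * (rpow (K a d) \<alpha> * rpow (K b c') \<alpha>) \<le> c * c * (rpow (K a c') \<alpha> * rpow (K b d) \<alpha>)"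
        using p3 by (intro mult_left_mono) auto
      then show "F (K a d) * F (K b c') \<le> F (K a c') * F (K b d)"
        using * nn p3 by (simp add: mult_ac)
    next
      fix a1 a2 a3 b1 b2 b3
      assume *: "3 \<le> p" "{a1, a2, a3, b1, b2, b3} \<subseteq> X" "a1 < a2" "a2 < a3" "b1 < b2" "b2 < b3"
      let ?k = "\<lambda>a b. K a b powr \<alpha>"
      have "0 \<le> ?k a1 b1 * (?k a2 b2 * ?k a3 b3 - ?k a2 b3 * ?k a3 b2)
        - ?k a1 b2 * (?k a2 b1 * ?k a3 b3 - ?k a2 b3 * ?k a3 b1)
        + ?k a1 b3 * (?k a2 b1 * ?k a3 b2 - ?k a2 b2 * ?k a3 b1)"
        by (rule powr_minor3_nonneg[OF p3(3)])
          (use * nn TN_kernel_on_minor3[OF K] in \<open>auto intro!: m2\<close>)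
      then have "0 \<le> c ^ 3 * (?k a1 b1 * (?k a2 b2 * ?k a3 b3 - ?k a2 b3 * ?k a3 b2)
        - ?k a1 b2 * (?k a2 b1 * ?k a3 b3 - ?k a2 b3 * ?k a3 b1)
        + ?k a1 b3 * (?k a2 b1 * ?k a3 b2 - ?k a2 b2 * ?k a3 b1))"
        using p3 by simp
      then show "0 \<le> F (K a1 b1) * (F (K a2 b2) * F (K a3 b3) - F (K a2 b3) * F (K a3 b2))
        - F (K a1 b2) * (F (K a2 b1) * F (K a3 b3) - F (K a2 b3) * F (K a3 b1))
        + F (K a1 b3) * (F (K a2 b1) * F (K a3 b2) - F (K a2 b2) * F (K a3 b1))"
        using * nn by (simp add: F power3_eq_cube algebra_simps)
    qed (use p3 nn in \<open>auto simp: rpow_nonneg\<close>)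
  next
    case p4
    have "TN_kernel_on p X (\<lambda>x y. F (K x y)) = TN_kernel_on p X (\<lambda>x y. c * K x y)"
      using p4 nn by (intro TN_kernel_on_cong) auto
    moreover have "TN_kernel_on p X (\<lambda>x y. c * K x y)"
      unfolding TN_kernel_on_def
    proof (intro allI impI, elim conjE)
      fix n :: nat and x y :: "nat \<Rightarrow> 'a"
      assume *: "1 \<le> n" "n \<le> p" "strict_mono_on {..<n} x" "x ` {..<n} \<subseteq> X"
        "strict_mono_on {..<n} y" "y ` {..<n} \<subseteq> X"
      show "0 \<le> det (mat n n (\<lambda>(i, j). c * K (x i) (y j)))"
        using TN_kernel_onD[OF K *] p4 by (simp add: det_mat_smult)
    qed
    ultimately show ?thesis by simp
  qed
qed

section \<open>Test kernels\<close>

text \<open>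
  The points (x, y) lie in convex position, except that the middle three are collinear; 3 x 3 minors of the kernel
  \<open>1 + t \<langle>P\<^sub>i, P\<^sub>j\<rangle>\<close> are \<open>t\<^sup>2\<close> times products of two orientations of triples. The 4 x 4 minor with rows 0..3 and
  columns 1..4 becomes negative under powers since the affine dependence among the three collinear points has
  opposite parity in the two index sets.
\<close>

definition gram_x :: "nat \<Rightarrow> real" where
  "gram_x i = (if i = 0 then -3 else if i = 1 then -1 else if i = 2 then 0 else if i = 3 then 1 else 3)"

definition gram_y :: "nat \<Rightarrow> real" where
  "gram_y i = (if i = 0 \<or> i = 4 then 1 else 0)"

definition gram_kernel :: "real \<Rightarrow> nat \<Rightarrow> nat \<Rightarrow> real" where
  "gram_kernel t i j = 1 + t * (gram_x i * gram_x j + gram_y i * gram_y j)"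

lemma less_5_cases:
  fixes b :: nat
  assumes "b < 5"
  obtains "b = 0" | "b = 1" | "b = 2" | "b = 3" | "b = 4"
  using assms by linarith

text \<open>Entries are at least \<open>1 - 8 * t\<close> and 2 x 2 minors at least
  \<open>t * (3 / 4 - 36 * t)\<close>, whence the bound \<open>1 / 48\<close>. Minors of size 4 or
  more vanish, as the rank is at most 3.\<close>

lemma TN_gram_kernel:
  assumes t: "0 < t" "t \<le> 1 / 48"
  shows "TN_kernel_on p {..<5} (gram_kernel t)"
proof (rule TN_kernel_onI)
  fix a b :: nat assume "a \<in> {..<5}" "b \<in> {..<5}"
  then have "- 8 \<le> gram_x a * gram_x b + gram_y a * gram_y b"
    by (auto elim!: less_5_cases simp: gram_x_def gram_y_def)
  then have "t * - 8 \<le> t * (gram_x a * gram_x b + gram_y a * gram_y b)"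
    using t by (intro mult_left_mono) auto
  then show "0 \<le> gram_kernel t a b"
    using t by (simp add: gram_kernel_def)
next
  fix a b c d :: nat assume *: "{a, b, c, d} \<subseteq> {..<5}" "a < b" "c < d"
  \<comment> \<open>The 2 x 2 minor is \<open>t\<close> times the scalar product of two chords plus
    \<open>t^2\<close> times a product of two cross products \<open>cr\<close>. Chords have slope at
    most 1/2 in absolute value, which keeps the scalar product above 3/4.\<close>
  define dx where "dx a b = gram_x b - gram_x a" for a b
  define dy where "dy a b = gram_y b - gram_y a" for a b
  define cr where "cr a b = gram_x a * gram_y b - gram_x b * gram_y a" for a b
  have bounds: "1 \<le> dx a b \<and> 2 * \<bar>dy a b\<bar> \<le> dx a b \<and> \<bar>cr a b\<bar> \<le> 6" if "a < b" "b < 5" for a b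
    using that(2,1) less_trans[OF that]
    by (auto elim!: less_5_cases simp: dx_def dy_def cr_def gram_x_def gram_y_def)
  have ab: "1 \<le> dx a b" "2 * \<bar>dy a b\<bar> \<le> dx a b" "\<bar>cr a b\<bar> \<le> 6"
    and cd: "1 \<le> dx c d" "2 * \<bar>dy c d\<bar> \<le> dx c d" "\<bar>cr c d\<bar> \<le> 6"
    using bounds * by auto
  have "\<bar>2 * dy a b\<bar> * \<bar>2 * dy c d\<bar> \<le> dx a b * dx c d"
    using ab cd by (intro mult_mono) auto
  then have "- (dx a b * dx c d) \<le> 4 * (dy a b * dy c d)"
    by (simp flip: abs_mult)
  moreover have "1 \<le> dx a b * dx c d"
    using mult_mono[OF ab(1) cd(1)] ab by simp
  ultimately have 1: "3 / 4 \<le> dx a b * dx c d + dy a b * dy c d" by simp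
  have "\<bar>cr a b * cr c d\<bar> \<le> 6 * 6"
    unfolding abs_mult using ab cd by (intro mult_mono) auto
  then have "- 36 \<le> cr a b * cr c d" by (simp add: abs_le_iff)
  then have "t * - 36 \<le> t * (cr a b * cr c d)" using t by (intro mult_left_mono) auto
  with 1 t have "0 \<le> dx a b * dx c d + dy a b * dy c d + t * (cr a b * cr c d)" by simp
  then have "0 \<le> t * (dx a b * dx c d + dy a b * dy c d + t * (cr a b * cr c d))"
    using t by simp
  then show "gram_kernel t a d * gram_kernel t b c \<le> gram_kernel t a c * gram_kernel t b d"
    unfolding gram_kernel_def dx_def dy_def cr_def by (simp add: algebra_simps)
next
  fix a b c d e f :: nat
  assume *: "{a, b, c, d, e, f} \<subseteq> {..<5}" "a < b" "b < c" "d < e" "e < f"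
  define D where "D a b c = (gram_x b - gram_x a) * (gram_y c - gram_y a)
    - (gram_x c - gram_x a) * (gram_y b - gram_y a)" for a b c
  have D: "0 \<le> D a b c" if "a < b" "b < c" "c < 5" for a b c
  proof -
    have "a < 5" "b < 5" using that by auto
    with that show ?thesis
      by (auto elim!: less_5_cases simp: D_def gram_x_def gram_y_def)
  qed
  have "0 \<le> t ^ 2 * (D a b c * D d e f)" using D * by simp
  then show "0 \<le> gram_kernel t a d * (gram_kernel t b e * gram_kernel t c f - gram_kernel t b f * gram_kernel t c e)
    - gram_kernel t a e * (gram_kernel t b d * gram_kernel t c f - gram_kernel t b f * gram_kernel t c d)
    + gram_kernel t a f * (gram_kernel t b d * gram_kernel t c e - gram_kernel t b e * gram_kernel t c d)"
    unfolding gram_kernel_def D_def by (simp add: algebra_simps power2_eq_square)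
next
  fix n :: nat and x y :: "nat \<Rightarrow> nat" assume "4 \<le> n"
  have "(\<lambda>(i, j). gram_kernel t (x i) (y j)) = (\<lambda>(i, j). \<Sum>k<3::nat.
      (if k = 0 then 1 else if k = 1 then t * gram_x (x i) else t * gram_y (x i))
      * (if k = 0 then 1 else if k = 1 then gram_x (y j) else gram_y (y j)))"
    by (auto simp: gram_kernel_def numeral_3_eq_3 algebra_simps)
  then show "0 \<le> det (mat n n (\<lambda>(i, j). gram_kernel t (x i) (y j)))"
    using \<open>4 \<le> n\<close> by (simp only: det_mat_low_rank)
qed

text \<open>Subtracting row 2, which consists of ones, from the other rows clears column 1 outside
  row 2. What remains is minus the 3 x 3 determinant with rows \<open>(X, X', Z)\<close>,
  \<open>(A, A', X')\<close>, \<open>(A', A, X)\<close>.\<close>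

lemma det_mat_4_centered:
  fixes A A' X X' Z :: "'a::comm_ring_1"
  assumes "\<And>j. j < 4 \<Longrightarrow> f 2 j = 1" "\<And>i. i < 4 \<Longrightarrow> f i 1 = 1"
    and "f 0 0 = 1 + X" "f 0 2 = 1 + X'" "f 0 3 = 1 + Z"
    and "f 1 0 = 1 + A" "f 1 2 = 1 + A'" "f 1 3 = 1 + X'"
    and "f 3 0 = 1 + A'" "f 3 2 = 1 + A" "f 3 3 = 1 + X"
  shows "det (mat 4 4 (\<lambda>(i, j). f i j))
    = - (A' * (X\<^sup>2 + X'\<^sup>2) - 2 * A * X * X' + Z * (A\<^sup>2 - A'\<^sup>2))"
  using assms(1)[of 0] assms(1)[of 1] assms(1)[of 2] assms(1)[of 3]
    assms(2)[of 0] assms(2)[of 1] assms(2)[of 3] assms(3-)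
  unfolding det_mat_4 det_mat_3
  by (simp add: numeral_eq_Suc lessThan_Suc)
    (simp add: algebra_simps power2_eq_square)

lemma ex_gram_kernel_powr_not_TN:
  assumes \<alpha>: "1 < \<alpha>" and p: "4 \<le> p" and c: "0 < c"
  obtains t where "0 < t" "t \<le> 1 / 48"
    "\<not> TN_kernel_on p {..<5} (\<lambda>i j. c * gram_kernel t i j powr \<alpha>)"
proof -
  obtain t where t: "0 < t" "t < 1 / 48" and pos:
    "((1 - t) powr \<alpha> - 1) * (((1 + 3 * t) powr \<alpha> - 1)\<^sup>2 + ((1 - 3 * t) powr \<alpha> - 1)\<^sup>2)
     - 2 * ((1 + t) powr \<alpha> - 1) * ((1 + 3 * t) powr \<alpha> - 1) * ((1 - 3 * t) powr \<alpha> - 1)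
     + ((1 - 8 * t) powr \<alpha> - 1) * (((1 + t) powr \<alpha> - 1)\<^sup>2 - ((1 - t) powr \<alpha> - 1)\<^sup>2) > 0"
    using ex_powr_gram_minor_pos[OF \<alpha>, of "1 / 48"] by auto
  \<comment> \<open>\<open>Suc\<close> selects the columns 1..4. The point with index 2 is the
    origin, so row 2 and column 1 of this minor consist of ones.\<close>
  let ?f = "\<lambda>i j. gram_kernel t i (Suc j) powr \<alpha>"
  have cases4: "j = 0 \<or> j = 1 \<or> j = 2 \<or> j = 3" if "j < 4" for j :: nat using that by auto
  have "det (mat 4 4 (\<lambda>(i, j). ?f i j)) < 0"
    by (subst det_mat_4_centered[where X = "(1 + 3 * t) powr \<alpha> - 1" and X' = "(1 - 3 * t) powr \<alpha> - 1"
        and A = "(1 + t) powr \<alpha> - 1" and A' = "(1 - t) powr \<alpha> - 1" and Z = "(1 - 8 * t) powr \<alpha> - 1"])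
      (use pos in \<open>auto dest!: cases4 simp: gram_kernel_def gram_x_def gram_y_def mult.commute[of t]\<close>)
  then have "c ^ 4 * det (mat 4 4 (\<lambda>(i, j). ?f i j)) < 0"
    using c by (simp add: mult_pos_neg)
  then have "det (mat 4 4 (\<lambda>(i, j). c * ?f i j)) < 0"
    by (simp only: det_mat_smult)
  moreover have "strict_mono_on {..<4} (\<lambda>i::nat. i)" "(\<lambda>i. i) ` {..<4} \<subseteq> {..<5::nat}"
    "strict_mono_on {..<4} Suc" "Suc ` {..<4} \<subseteq> {..<5}"
    by (auto simp: strict_mono_on_def)
  ultimately have "\<not> TN_kernel_on p {..<5} (\<lambda>i j. c * gram_kernel t i j powr \<alpha>)"
    using TN_kernel_onD[of p "{..<5}" "\<lambda>i j. c * gram_kernel t i j powr \<alpha>" 4 "\<lambda>i. i" Suc] p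
    by auto
  with t show ?thesis by (intro that[of t]) auto
qed

text \<open>The value \<open>sqrt (1 / 2)\<close> makes the determinant 0. The entrywise power has
  determinant \<open>1 - 2 * (1 / 2) powr \<alpha>\<close>, negative for \<alpha> < 1, and the
  indicator gives -1.\<close>

definition tridiagonal_kernel :: "nat \<Rightarrow> nat \<Rightarrow> real" where
  "tridiagonal_kernel i j = (if i = j then 1 else if i = Suc j \<or> j = Suc i then sqrt (1 / 2) else 0)"

lemma TN_tridiagonal_kernel: "TN_kernel_on p {..<3} tridiagonal_kernel"
proof (rule TN_kernel_on_lessThanI)
  fix a b c d :: nat assume *: "a < b" "b < 3" "c < d" "d < 3"
  have pairs: "(a = 0 \<and> b = 1) \<or> (a = 0 \<and> b = 2) \<or> (a = 1 \<and> b = 2)"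
    if "a < b" "b < 3" for a b :: nat using that by auto
  show "tridiagonal_kernel a d * tridiagonal_kernel b c \<le> tridiagonal_kernel a c * tridiagonal_kernel b d"
    using pairs[of a b] pairs[of c d] * by (auto simp: tridiagonal_kernel_def simp flip: real_sqrt_mult)
qed (auto simp: tridiagonal_kernel_def simp flip: real_sqrt_mult)

section \<open>Necessity\<close>

text \<open>The test inputs have size 1, then 2 and 3 once \<open>p \<ge> 2\<close>, and 5 only for
  \<open>p \<ge> 4\<close>; all of these are at most \<open>p + 1\<close>.\<close>

lemma TN_preserver_form_necessary:
  assumes "0 < p"
    and pres: "\<And>m K. \<lbrakk>m \<le> p + 1; sym_kernel_on {..<m::nat} K; TN_kernel_on p {..<m} K\<rbrakk>
      \<Longrightarrow> TN_kernel_on p {..<m} (\<lambda>i j. F (K i j))"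
  shows "TN_preserver_form p F"
proof -
  have rank1: "TN_kernel_on p {..<m} (\<lambda>i j. F (u i * u j))"
    if "m \<le> p + 1" "\<And>i. i < m \<Longrightarrow> 0 \<le> u i" for m u
    using that by (intro pres TN_kernel_on_rank1) (auto simp: sym_kernel_on_def mult.commute)
  have nn: "0 \<le> F x" if "0 \<le> x" for x
    using TN_kernel_on_entry[OF rank1[of 1 "\<lambda>_. sqrt x"], of 0 0] that \<open>0 < p\<close> by auto
  show ?thesis
  proof (cases "p = 1")
    case True
    then show ?thesis using nn by (auto simp: TN_preserver_form_def)
  next
    case False
    then have p: "2 \<le> p" using \<open>0 < p\<close> by simp
    have mono: "F x \<le> F y" if "0 \<le> x" "x \<le> y" for x y
    proof -
      have xy: "x * x \<le> y * y" using that by (intro mult_mono) auto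
      let ?K = "\<lambda>i j :: nat. if i = j then y else x"
      have "TN_kernel_on p {..<2} ?K"
      proof (rule TN_kernel_on_lessThanI)
        fix a b c d :: nat assume "a < b" "b < 2" "c < d" "d < 2"
        then have "a = 0" "b = 1" "c = 0" "d = 1" by auto
        then show "?K a d * ?K b c \<le> ?K a c * ?K b d" using xy by simp
      qed (use that in auto)
      moreover have "sym_kernel_on {..<2} ?K" by (auto simp: sym_kernel_on_def)
      ultimately have "TN_kernel_on p {..<2} (\<lambda>i j. F (?K i j))"
        using p by (intro pres) auto
      from TN_kernel_on_minor2[OF this p, of 0 1 0 1] have "F x * F x \<le> F y * F y" by simp
      then have "(F x)\<^sup>2 \<le> (F y)\<^sup>2" unfolding power2_eq_square .
      moreover have "0 \<le> F y" using that by (intro nn) simp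
      ultimately show ?thesis by (rule power2_le_imp_le)
    qed
    \<comment> \<open>Before \<open>F\<close> is applied, this minor of the rank 1 matrix is 0.
      Taking rows 0, 1 and columns 1, 2 gives a block that need not be symmetric inside a symmetric
      matrix.\<close>
    have minor: "F (x * z) * F (y * y) \<le> F (x * y) * F (y * z)" if "0 \<le> x" "0 \<le> y" "0 \<le> z" for x y z
    proof -
      let ?u = "\<lambda>i :: nat. if i = 0 then x else if i = 1 then y else z"
      have "TN_kernel_on p {..<3} (\<lambda>i j. F (?u i * ?u j))"
        using that p by (intro rank1) auto
      from TN_kernel_on_minor2[OF this p, of 0 1 1 2] show ?thesis by simp
    qed
    from TN2_functional_equation_solution[of F, OF nn mono minor]
    consider (const) "\<exists>c\<ge>0. \<forall>x\<ge>0. F x = c"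
      | (power) c \<alpha> where "0 < c" "0 < \<alpha>" "\<And>x. 0 \<le> x \<Longrightarrow> F x = c * x powr \<alpha>"
      | (ind) c where "0 < c" "\<And>x. 0 \<le> x \<Longrightarrow> F x = (if x = 0 then 0 else c)"
      by blast
    then show ?thesis
    proof cases
      case const
      then show ?thesis by (simp add: TN_preserver_form_def)
    next
      case ind
      show ?thesis
      proof (cases "p = 2")
        case True
        then show ?thesis using ind by (auto simp: TN_preserver_form_def)
      next
        case False
        then have "3 \<le> p" using p by simp
        then have "TN_kernel_on p {..<3} (\<lambda>i j. F (tridiagonal_kernel i j))"
          by (intro pres TN_tridiagonal_kernel) (auto simp: sym_kernel_on_def tridiagonal_kernel_def)
        from TN_kernel_on_minor3[OF this \<open>3 \<le> p\<close>, of 0 1 2 0 1 2] have False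
          using ind by (simp add: tridiagonal_kernel_def mult_le_0_iff)
        then show ?thesis ..
      qed
    next
      case power
      have F: "F x = c * rpow x \<alpha>" if "0 \<le> x" for x
        using power that by (simp add: rpow_eq_powr)
      show ?thesis
      proof (cases "p = 2")
        case True
        have "\<exists>c>0. \<exists>\<alpha>\<ge>0. \<forall>x\<ge>0. F x = c * rpow x \<alpha>"
          using F power(1,2) by (intro exI[of _ c] exI[of _ \<alpha>] conjI) auto
        then show ?thesis using True unfolding TN_preserver_form_def by blast
      next
        case False
        then have p3: "3 \<le> p" using p by simp
        then have "TN_kernel_on p {..<3} (\<lambda>i j. F (tridiagonal_kernel i j))"
          by (intro pres TN_tridiagonal_kernel) (auto simp: sym_kernel_on_def tridiagonal_kernel_def)
        from TN_kernel_on_minor3[OF this p3, of 0 1 2 0 1 2]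
        have "0 \<le> c * (c * c) - 2 * (c * (c * sqrt (1 / 2) powr \<alpha> * (c * sqrt (1 / 2) powr \<alpha>)))"
          using power by (simp add: tridiagonal_kernel_def algebra_simps)
        also have "c * sqrt (1 / 2) powr \<alpha> * (c * sqrt (1 / 2) powr \<alpha>) = c * c * (1 / 2) powr \<alpha>"
          by (simp add: mult_ac flip: powr_mult)
        also have "c * (c * c) - 2 * (c * (c * c * (1 / 2) powr \<alpha>)) = c * (c * c) * (1 - 2 * (1 / 2) powr \<alpha>)"
          by (simp add: algebra_simps)
        finally have "0 \<le> c * (c * c) * (1 - 2 * (1 / 2) powr \<alpha>)" .
        moreover have "0 < c * (c * c)" using power by simp
        ultimately have "\<not> 1 - 2 * (1 / 2) powr \<alpha> < 0" by (meson mult_pos_neg not_le)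
        then have "(1 / 2) powr \<alpha> \<le> (1 / 2 :: real) powr 1" by simp
        then have \<alpha>: "1 \<le> \<alpha>"
          using powr_less_mono'[of "1 / 2" \<alpha> 1] by (cases "\<alpha> < 1") auto
        show ?thesis
        proof (cases "p = 3")
          case True
          have "\<exists>c>0. \<exists>\<alpha>\<ge>1. \<forall>x\<ge>0. F x = c * rpow x \<alpha>"
            using F power(1) \<alpha> by (intro exI[of _ c] exI[of _ \<alpha>] conjI) auto
          then show ?thesis using True unfolding TN_preserver_form_def by blast
        next
          case False
          then have p4: "4 \<le> p" using p3 by simp
          have "\<alpha> = 1"
          proof (rule ccontr)
            assume "\<alpha> \<noteq> 1"
            then obtain t where t: "0 < t" "t \<le> 1 / 48"
              and not: "\<not> TN_kernel_on p {..<5} (\<lambda>i j. c * gram_kernel t i j powr \<alpha>)"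
              using ex_gram_kernel_powr_not_TN[of \<alpha> p c] \<alpha> p4 power(1) by auto
            have "TN_kernel_on p {..<5} (\<lambda>i j. F (gram_kernel t i j))"
              using p4 t by (intro pres TN_gram_kernel) (auto simp: sym_kernel_on_def gram_kernel_def mult.commute)
            moreover have "TN_kernel_on p {..<5} (\<lambda>i j. F (gram_kernel t i j))
              = TN_kernel_on p {..<5} (\<lambda>i j. c * gram_kernel t i j powr \<alpha>)"
              using TN_kernel_on_entry[OF TN_gram_kernel[OF t] \<open>0 < p\<close>[folded Suc_le_eq, folded One_nat_def]]
                power(3) by (intro TN_kernel_on_cong) auto
            ultimately show False using not by simp
          qed
          then have "\<forall>x\<ge>0. F x = c * x" using power(3) by auto
          then show ?thesis using p4 power(1) unfolding TN_preserver_form_def by blast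
        qed
      qed
    qed
  qed
qed

section \<open>The characterization on chains and for matrices\<close>

text \<open>Necessity embeds the test chains into \<open>X\<close>. The infinite case is a separate
  alternative because \<open>card\<close> of an infinite set is 0.\<close>

lemma preserves_TN_sym_kernel_iff:
  fixes X :: "'a::linorder set"
  assumes "0 < p" "infinite X \<or> p + 1 \<le> card X"
  shows "preserves_TN_sym_kernel p X F \<longleftrightarrow> TN_preserver_form p F"
proof
  assume pres: "preserves_TN_sym_kernel p X F"
  show "TN_preserver_form p F"
    using assms by (intro TN_preserver_form_necessary preserves_TN_sym_kernel_embed[OF pres]) auto
next
  assume "TN_preserver_form p F"
  then show "preserves_TN_sym_kernel p X F"
    using TN_preserver_form_sufficient assms(1) unfolding preserves_TN_sym_kernel_def by blast
qed

theorem theorem3p7: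
  fixes F :: "real \<Rightarrow> real" and d p :: nat
  assumes "0 < d" and "0 < p" and "p < d"
  shows "(preserves_TN_sym_mat p d F \<longleftrightarrow> preserves_TN_mat p d F)
    \<and> (preserves_TN_mat p d F \<longleftrightarrow> TN_preserver_form p F)
    \<and> (\<forall>X :: 'a::linorder set. infinite X \<or> p + 1 \<le> card X \<longrightarrow>
         (preserves_TN_sym_kernel p X F \<longleftrightarrow> TN_preserver_form p F))"
proof -
  \<comment> \<open>The implications form a cycle: all matrices, symmetric matrices, the explicit
    form, all matrices. The middle one is the kernel result on \<open>{..<d}\<close>, which has at
    least \<open>p + 1\<close> elements as \<open>p < d\<close>.\<close>
  have "preserves_TN_mat p d F \<Longrightarrow> preserves_TN_sym_mat p d F"
    by (simp add: preserves_TN_mat_def preserves_TN_sym_mat_def)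
  moreover have "preserves_TN_sym_mat p d F \<Longrightarrow> TN_preserver_form p F"
    using preserves_TN_sym_mat_imp_kernel[of p d F] preserves_TN_sym_kernel_iff[of p "{..<d}" F] assms by simp
  moreover have "TN_preserver_form p F \<Longrightarrow> preserves_TN_mat p d F"
    using TN_preserver_form_sufficient assms(2) by (intro preserves_TN_kernel_imp_mat) blast
  ultimately show ?thesis
    using preserves_TN_sym_kernel_iff[OF assms(2)] by blast
qed

end
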